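(* For every integer $d\ge1$ and all sufficiently large $N$, \[ \mathfrak{S}_{\mathbb{T}^d}(N)\gtrsim_d (\log N)^d \quad\text{and}\quad \mathfrak{M}_{\mathbb{T}^d}(N)\gtrsim_d (\log N)^d. \] Also, for every integer $d\ge1$ and all sufficiently large positive integers $n$, \[ \widetilde{\mathfrak{S}}_{\mathbb{T}^d}(n)\sim_d n \quad\text{and}\quad \widetilde{\mathfrak{M}}_{\mathbb{T}^d}(n)\sim_d n. \]
   Context: Notation: $X\gtrsim_d Y$ means $X\ge c_d Y$ for a constant $c_d>0$ depending only on $d$; $X\sim_d Y$ means $X\gtrsim_d Y$ and $Y\gtrsim_d X$. Let $\mathbb{T}^d=\mathbb{R}^d/\mathbb{Z}^d$. A weight is a nonnegative (locally) integrable function $w$ on $\mathbb{T}^d\times\mathbb{T}$; put $\rho^{\ast}_{\mathbb{Z}^d}w(x,k)=\int_0^1 w(x-2tk,t)\,\mathrm{d}t\in[0,\infty]$ for $(x,k)\in\mathbb{T}^d\times\mathbb{Z}^d$, with $0\cdot\infty=0$. For a trigonometric polynomial $u_0$ on $\mathbb{T}^d$ put \[ u(x,t)=\sum_{k\in\mathbb{Z}^d}\widehat{u_0}(k)e^{2\pi i(x\cdot k+t|k|^2)},\quad (x,t)\in\mathbb{T}^d\times\mathbb{T}. \] Consider the inequalities \[ \text{(Stein)}\quad \int_{\mathbb{T}} \int_{\mathbb{T}^d} |u|^2w\,\mathrm{d}x\,\mathrm{d}t\leq C\sum_{k\in\mathbb{Z}^d}|\widehat{u_0}(k)|^2\sup_{x\in\mathbb{T}^d}\rho^{\ast}_{\mathbb{Z}^{d}}w(x,k),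 \] \[ \text{(MT)}\quad \int_{\mathbb{T}} \int_{\mathbb{T}^d} |u|^2w\,\mathrm{d}x\,\mathrm{d}t\leq C \sup_{x\in\mathbb{T}^d,\ k\in\operatorname{supp}\widehat{u_0}}\rho^{\ast}_{\mathbb{Z}^{d}}w(x,k) \,\|u_0\|_{\mathrm{L}^2(\mathbb{T}^d)}^2. \] For $N\ge1$, $\mathfrak{S}_{\mathbb{T}^d}(N)$ and $\mathfrak{M}_{\mathbb{T}^d}(N)$ are the least constants $C\in[0,\infty]$ such that (Stein), respectively (MT), holds for all weights $w$ and all trigonometric polynomials $u_0$ with $\operatorname{supp}\widehat{u_0}\subseteq\mathbb{Z}^d\cap[-N,N]^d$. For a positive integer $n$, $\widetilde{\mathfrak{S}}_{\mathbb{T}^d}(n)$ and $\widetilde{\mathfrak{M}}_{\mathbb{T}^d}(n)$ are the least constants $C\in[0,\infty]$ such that (Stein), respectively (MT), holds for all weights $w$ and all trigonometric polynomials $u_0$ with $\#\operatorname{supp}\widehat{u_0}=n$. *)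

theory Defs
  imports "HOL-Analysis.Analysis"
begin

text \<open>
  Functions on the torus $T^d = R^d / Z^d$ are represented by $1$-periodic functions on
  \<^typ>\<open>real ^ 'd\<close>, and their integrals are taken over the cell \<open>cbox 0 1\<close>, i.e. $[0,1]^d$.
  The dimension is \<open>d = CARD('d)\<close>, which is at least 1.
\<close>

definition zvec :: "int ^ 'd \<Rightarrow> real ^ 'd::finite" where
  "zvec k = (\<chi> i. real_of_int (k $ i))"

definition trig_polys :: "(real ^ 'd::finite \<Rightarrow> complex) set" where
  "trig_polys = {u0. \<exists>F a. finite F \<and> u0 = (\<lambda>x. \<Sum>k\<in>F. a k * cis (2 * pi * (x \<bullet> zvec k)))}"

definition fourier :: "(real ^ 'd::finite \<Rightarrow> complex) \<Rightarrow> int ^ 'd \<Rightarrow> complex" where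
  "fourier u0 k = (LINT x:cbox 0 1|lebesgue. u0 x * cis (- 2 * pi * (x \<bullet> zvec k)))"

definition spectrum :: "(real ^ 'd::finite \<Rightarrow> complex) \<Rightarrow> (int ^ 'd) set" where
  "spectrum u0 = {k. fourier u0 k \<noteq> 0}"

text \<open>
  Sums over $Z^d$ weighted by Fourier coefficients are written as sums over the
  spectrum, which is finite for trigonometric polynomials.
\<close>

definition schroedinger :: "(real ^ 'd::finite \<Rightarrow> complex) \<Rightarrow> real ^ 'd \<Rightarrow> real \<Rightarrow> complex" where
  "schroedinger u0 x t =
     (\<Sum>k\<in>spectrum u0. fourier u0 k * cis (2 * pi * (x \<bullet> zvec k + t * (norm (zvec k))\<^sup>2)))"

text \<open>
  A weight is a genuine function, not a class modulo null sets, since it is integrated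
  along lines below.  For Lebesgue measurable functions the restriction to a particular line
  may fail to be measurable; the last condition says that all the line integrals
  defining \<open>rho_star\<close> make sense in $[0,\infty]$.  It holds for every Borel function.
\<close>

definition weights :: "((real ^ 'd::finite) \<times> real \<Rightarrow> real) set" where
  "weights = {w.
     (\<forall>z. 0 \<le> w z) \<and>
     (\<forall>x t k m. w (x + zvec k, t + real_of_int m) = w (x, t)) \<and>
     set_integrable lebesgue (cbox 0 1 \<times> {0..1}) w \<and>
     (\<forall>x k. (\<lambda>t. w (x - (2 * t) *\<^sub>R zvec k, t)) \<in> borel_measurable lebesgue)}"

definition rho_star ::
    "((real ^ 'd::finite) \<times> real \<Rightarrow> real) \<Rightarrow> real ^ 'd \<Rightarrow> int ^ 'd \<Rightarrow> ennreal" where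
  "rho_star w x k = (\<integral>\<^sup>+ t\<in>{0..1}. ennreal (w (x - (2 * t) *\<^sub>R zvec k, t)) \<partial>lebesgue)"

definition weighted_energy ::
    "((real ^ 'd::finite) \<times> real \<Rightarrow> real) \<Rightarrow> (real ^ 'd \<Rightarrow> complex) \<Rightarrow> ennreal" where
  "weighted_energy w u0 =
     (\<integral>\<^sup>+ t\<in>{0..1}. (\<integral>\<^sup>+ x\<in>cbox 0 1.
        ennreal ((cmod (schroedinger u0 x t))\<^sup>2 * w (x, t)) \<partial>lebesgue) \<partial>lebesgue)"

definition L2_norm_sq :: "(real ^ 'd::finite \<Rightarrow> complex) \<Rightarrow> ennreal" where
  "L2_norm_sq u0 = (\<integral>\<^sup>+ x\<in>cbox 0 1. ennreal ((cmod (u0 x))\<^sup>2) \<partial>lebesgue)"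

text \<open>In \<^typ>\<open>ennreal\<close> one has \<open>0 * \<infinity> = 0\<close>, as required in the two inequalities below.\<close>

definition stein_ineq ::
    "ennreal \<Rightarrow> ((real ^ 'd::finite) \<times> real \<Rightarrow> real) \<Rightarrow> (real ^ 'd \<Rightarrow> complex) \<Rightarrow> bool" where
  "stein_ineq C w u0 \<longleftrightarrow>
     weighted_energy w u0 \<le>
       C * (\<Sum>k\<in>spectrum u0. ennreal ((cmod (fourier u0 k))\<^sup>2) * (SUP x. rho_star w x k))"

definition mt_ineq ::
    "ennreal \<Rightarrow> ((real ^ 'd::finite) \<times> real \<Rightarrow> real) \<Rightarrow> (real ^ 'd \<Rightarrow> complex) \<Rightarrow> bool" where
  "mt_ineq C w u0 \<longleftrightarrow>
     weighted_energy w u0 \<le>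
       C * (SUP (x, k)\<in>UNIV \<times> spectrum u0. rho_star w x k) * L2_norm_sq u0"

definition in_box :: "real \<Rightarrow> (int ^ 'd::finite) set" where
  "in_box N = {k. \<forall>i. \<bar>real_of_int (k $ i)\<bar> \<le> N}"

text \<open>
  The least admissible constant in $[0,\infty]$ is expressed as an infimum; the admissible
  set is upward closed,
  and by continuity of multiplication a nonzero infimum is itself
  admissible.  The scale \<open>N\<close> is a real number.
\<close>

definition stein_const :: "'d::finite itself \<Rightarrow> real \<Rightarrow> ennreal" where
  "stein_const _ N = Inf {C. \<forall>w\<in>weights. \<forall>u0\<in>trig_polys.
     spectrum u0 \<subseteq> (in_box N :: (int ^ 'd) set) \<longrightarrow> stein_ineq C w u0}"

definition mt_const :: "'d::finite itself \<Rightarrow> real \<Rightarrow> ennreal" where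
  "mt_const _ N = Inf {C. \<forall>w\<in>weights. \<forall>u0\<in>trig_polys.
     spectrum u0 \<subseteq> (in_box N :: (int ^ 'd) set) \<longrightarrow> mt_ineq C w u0}"

definition stein_const_card :: "'d::finite itself \<Rightarrow> nat \<Rightarrow> ennreal" where
  "stein_const_card _ n = Inf {C. \<forall>w\<in>weights. \<forall>u0\<in>trig_polys.
     card (spectrum u0 :: (int ^ 'd) set) = n \<longrightarrow> stein_ineq C w u0}"

definition mt_const_card :: "'d::finite itself \<Rightarrow> nat \<Rightarrow> ennreal" where
  "mt_const_card _ n = Inf {C. \<forall>w\<in>weights. \<forall>u0\<in>trig_polys.
     card (spectrum u0 :: (int ^ 'd) set) = n \<longrightarrow> mt_ineq C w u0}"

end

theory Submission
  imports Defs
begin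

text \<open>
  By Parseval, Stein's inequality implies the Mizohata-Takeuchi inequality with the same constant
  (\<open>stein_ineq_imp_mt_ineq\<close>). Hence it suffices to bound the Stein constants from above and the
  Mizohata-Takeuchi constants from below.

  The upper bound \<open>n\<close> is a mean value argument: \<open>|u|\<^sup>2\<close> is at most \<open>n\<close> times the sum of the squared
  coefficients by Cauchy-Schwarz, and for every \<open>k\<close> the total mass of \<open>w\<close> is the
  mean over \<open>x\<close> of the line integrals of \<open>w\<close> in the direction \<open>k\<close>, because \<open>(x, t) \<mapsto> (x - 2tk, t)\<close>
  preserves measure (\<open>nn_integral_weight_le_SUP_rho_star\<close>).

  For the lower bounds, let \<open>u\<^sub>0\<close> be the sum of the characters with frequencies in a finite set
  \<open>K\<close>, and let the weight be a Riesz product, a product of factors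
  \<open>1 + cos 2\<pi>(x \<cdot> \<beta>\<^sub>b + t \<tau>\<^sub>b)\<close>. On the line \<open>x - 2tm\<close> these factors have the frequencies
  \<open>\<tau>\<^sub>b - 2 m \<cdot> \<beta>\<^sub>b\<close>; if these are dissociated, that is, if no nontrivial combination of them with
  coefficients in \<open>{-1, 0, 1}\<close> vanishes, then every line integral in the direction \<open>m\<close> equals \<open>1\<close>
  (\<open>rho_star_riesz_product\<close>). In space-time, on the other hand, the weight is made to correlate with
  \<open>|u|\<^sup>2\<close>. Let \<open>K\<close> be a product of sets \<open>{3\<^sup>j | j \<in> J i}\<close> over the coordinates \<open>i\<close>, and let the
  pairs \<open>(\<beta>, \<tau>)\<close> be \<open>(3\<^sup>j e\<^sub>i, 9\<^sup>j)\<close> for \<open>j \<in> J i\<close>. Then every frequency \<open>(k - l, |k|\<^sup>2 - |l|\<^sup>2)\<close> of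
  \<open>|u|\<^sup>2\<close> is a signed sum of at most \<open>2d\<close> of these pairs, so that the weight has there a coefficient of
  at least \<open>4\<^sup>-\<^sup>d\<close>, and the energy is at least \<open>|K|\<^sup>2 / 4\<^sup>d\<close> (\<open>weighted_energy_riesz_product_ge\<close>). Since
  the squared \<open>L\<^sup>2\<close> norm of \<open>u\<^sub>0\<close> is \<open>|K|\<close>, the constant is at least \<open>|K| / 4\<^sup>d\<close>.

  Dissociation holds as soon as the sets \<open>J i\<close> are separated blocks, because then the line
  frequencies have pairwise distinct \<open>3\<close>-adic valuations (\<open>ternary_dissociated\<close>). Only the
  exponents in the union of the blocks are limited by the size of the frequencies, whereas \<open>|K|\<close> is the
  product of the sizes of the blocks: \<open>d\<close> blocks of length about \<open>log\<^sub>3 N / d\<close> fit into \<open>[-N, N]\<^sup>d\<close> and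
  give \<open>(log N)\<^sup>d\<close> up to a constant. One block of size \<open>n\<close> and \<open>d - 1\<close> blocks of size \<open>1\<close> give the lower bound in terms
  of the number \<open>n\<close> of frequencies.
\<close>

section \<open>Integrals of trigonometric sums\<close>

lemma integral_character_unit_interval:
  fixes n :: int
  shows "(LINT t:{0..1}|lborel. cis (2 * pi * (t * of_int n))) = of_bool (n = 0)"
proof (cases "n = 0")
  case True
  then show ?thesis
    by (simp add: set_lebesgue_integral_def)
next
  case False
  define F where "F t = cis (2 * pi * (t * of_int n)) / (\<i> * of_real (2 * pi * of_int n))" for t :: real
  have D: "(F has_vector_derivative cis (2 * pi * (t * of_int n))) (at t within A)" for t A
    unfolding F_def cis_conv_exp using False
    by (auto intro!: derivative_eq_intros has_vector_derivative_real_field simp: field_simps)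
  have "(LBINT t. indicat_real {0..1} t *\<^sub>R cis (2 * pi * (t * of_int n))) = F 1 - F 0"
    by (rule integral_FTC_Icc) (auto intro!: D continuous_intros)
  moreover have "cis (2 * pi * of_int n) = 1"
    by (rule cis_multiple_2pi) simp
  ultimately show ?thesis
    using False by (simp add: set_lebesgue_integral_def F_def)
qed

lemma cis_sum: "cis (\<Sum>i\<in>A. f i) = (\<Prod>i\<in>A. cis (f i))"
  by (induction A rule: infinite_finite_induct) (simp_all add: cis_mult[symmetric])

lemma one_inner_Basis: "(1::real^'d::finite) \<bullet> b = 1" if "b \<in> Basis"
  using that by (auto simp: Basis_vec_def inner_axis)

text \<open>
  Lebesgue measure is the product of its one-dimensional copies and a character is a product of
  one-dimensional characters, so that the integral factors over the coordinates.
\<close>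
lemma integral_character_unit_cube:
  fixes k :: "int ^ 'd::finite"
  shows "(LINT x:cbox 0 1|lborel. cis (2 * pi * (x \<bullet> zvec k))) = of_bool (k = 0)"
proof -
  interpret product_sigma_finite "\<lambda>_::real^'d. lborel :: real measure" ..
  \<comment> \<open>Basis vectors index the product measure, so the integer coordinates of \<open>k\<close> are read off by them.\<close>
  define m where "m b = \<lfloor>zvec k \<bullet> b\<rfloor>" for b
  have m: "zvec k \<bullet> b = of_int (m b)" if "b \<in> Basis" for b
    using that by (auto simp: m_def Basis_vec_def inner_axis zvec_def)
  define f where "f b s = indicat_real {0..1} s *\<^sub>R cis (2 * pi * (s * of_int (m b)))"
    for b :: "real^'d" and s
  have meas [measurable]: "f b \<in> borel_measurable borel" for b
  proof -
    have "(\<lambda>s. cis (2 * pi * (s * of_int (m b)))) \<in> borel_measurable borel"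
      by (intro borel_measurable_continuous_onI continuous_intros)
    then show ?thesis
      unfolding f_def by measurable
  qed
  have int: "integrable lborel (f b)" for b
  proof -
    have "set_integrable lborel {0..1} (\<lambda>s. cis (2 * pi * (s * of_int (m b))))"
      by (intro borel_integrable_atLeastAtMost' continuous_intros)
    then show ?thesis
      unfolding f_def set_integrable_def .
  qed
  have split: "indicat_real (cbox 0 1) x *\<^sub>R cis (2 * pi * (x \<bullet> zvec k)) = (\<Prod>b\<in>Basis. f b (x \<bullet> b))"
    for x :: "real^'d"
  proof -
    have ind: "indicat_real (cbox 0 1) x = (\<Prod>b\<in>Basis. indicator {0..1} (x \<bullet> b))"
      by (auto simp: indicator_def mem_box one_inner_Basis)
    have "x \<bullet> zvec k = (\<Sum>b\<in>Basis. (x \<bullet> b) * of_int (m b))"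
      by (subst euclidean_inner) (simp add: m)
    then have "cis (2 * pi * (x \<bullet> zvec k)) = (\<Prod>b\<in>Basis. cis (2 * pi * ((x \<bullet> b) * of_int (m b))))"
      by (simp add: cis_sum sum_distrib_left)
    then show ?thesis
      unfolding ind f_def scaleR_conv_of_real of_real_prod by (simp add: prod.distrib)
  qed
  have "(LINT x:cbox 0 1|lborel. cis (2 * pi * (x \<bullet> zvec k)))
      = (LINT x|lborel. (\<Prod>b\<in>Basis. f b (x \<bullet> b)))"
    unfolding set_lebesgue_integral_def split ..
  also have "\<dots> = (LINT g|(\<Pi>\<^sub>M b\<in>Basis. lborel). (\<Prod>b\<in>Basis. f b ((\<Sum>c\<in>Basis. g c *\<^sub>R c) \<bullet> b)))"
    by (subst lborel_eq) (rule integral_distr; measurable)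
  also have "\<dots> = (LINT g|(\<Pi>\<^sub>M b\<in>Basis. lborel). (\<Prod>b\<in>Basis. f b (g b)))"
    by simp
  also have "\<dots> = (\<Prod>b\<in>Basis. LINT s|lborel. f b s)"
    by (rule product_integral_prod) (auto simp: int)
  also have "\<dots> = (\<Prod>b\<in>(Basis::(real^'d) set). of_bool (m b = 0))"
    using integral_character_unit_interval
    by (simp add: f_def set_lebesgue_integral_def)
  also have "\<dots> = of_bool (\<forall>b\<in>(Basis::(real^'d) set). m b = 0)"
    by auto
  also have "(\<forall>b\<in>(Basis::(real^'d) set). m b = 0) \<longleftrightarrow> k = 0"
    by (auto simp: m_def Basis_vec_def inner_axis zvec_def vec_eq_iff)
  finally show ?thesis .
qed

lemma set_integral_finite_combination:
  fixes e :: "'s \<Rightarrow> 'a \<Rightarrow> complex"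
  assumes "\<And>s. s \<in> S \<Longrightarrow> set_integrable M A (e s)"
  shows set_integrable_finite_combination: "set_integrable M A (\<lambda>x. \<Sum>s\<in>S. C s * e s x)"
    and "(LINT x:A|M. \<Sum>s\<in>S. C s * e s x) = (\<Sum>s\<in>S. C s * (LINT x:A|M. e s x))"
proof -
  have int: "integrable M (\<lambda>x. indicator A x *\<^sub>R (C s * e s x))" if "s \<in> S" for s
    using assms[OF that, THEN set_integrable_mult_right, of "C s"] by (simp add: set_integrable_def)
  then show "set_integrable M A (\<lambda>x. \<Sum>s\<in>S. C s * e s x)"
    unfolding set_integrable_def scaleR_sum_right by (rule Bochner_Integration.integrable_sum)
  have "(LINT x:A|M. \<Sum>s\<in>S. C s * e s x) = (\<Sum>s\<in>S. LINT x:A|M. C s * e s x)"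
    unfolding set_lebesgue_integral_def scaleR_sum_right
    by (rule Bochner_Integration.integral_sum[OF int])
  then show "(LINT x:A|M. \<Sum>s\<in>S. C s * e s x) = (\<Sum>s\<in>S. C s * (LINT x:A|M. e s x))"
    by simp
qed

text \<open>
  The energies and line integrals of this development are integrals in \<open>[0, \<infinity>]\<close> of functions
  that are nonnegative but are known only as linear combinations of complex characters. This
  passes from the one kind of integral to the other.
\<close>
lemma nn_set_integral_finite_sum:
  fixes F :: "'a \<Rightarrow> real" and e :: "'s \<Rightarrow> 'a \<Rightarrow> complex"
  assumes "finite S" and nonneg: "\<And>x. 0 \<le> F x"
    and int: "\<And>s. s \<in> S \<Longrightarrow> set_integrable M A (e s)"
    and F: "\<And>x. complex_of_real (F x) = (\<Sum>s\<in>S. C s * e s x)"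
  shows "(\<integral>\<^sup>+x\<in>A. ennreal (F x) \<partial>M) = ennreal (Re (\<Sum>s\<in>S. C s * (LINT x:A|M. e s x)))"
proof -
  have int_sum: "set_integrable M A (\<lambda>x. \<Sum>s\<in>S. C s * e s x)"
    by (rule set_integrable_finite_combination) (rule int)
  have Re_F: "indicator A x *\<^sub>R F x = Re (indicator A x *\<^sub>R (\<Sum>s\<in>S. C s * e s x))" for x
    using F[of x, symmetric] by simp
  have intF: "integrable M (\<lambda>x. indicator A x *\<^sub>R F x)"
    unfolding Re_F using int_sum unfolding set_integrable_def by (rule integrable_Re)
  have "(\<integral>\<^sup>+x\<in>A. ennreal (F x) \<partial>M) = (\<integral>\<^sup>+x. ennreal (indicator A x *\<^sub>R F x) \<partial>M)"
    by (intro nn_integral_cong) (auto simp: indicator_def)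
  also have "\<dots> = ennreal (LINT x|M. indicator A x *\<^sub>R F x)"
    by (rule nn_integral_eq_integral[OF intF]) (simp add: nonneg)
  also have "(LINT x|M. indicator A x *\<^sub>R F x) = Re (LINT x|M. indicator A x *\<^sub>R (\<Sum>s\<in>S. C s * e s x))"
    unfolding Re_F using int_sum unfolding set_integrable_def by (rule integral_Re)
  also have "(LINT x|M. indicator A x *\<^sub>R (\<Sum>s\<in>S. C s * e s x)) = (\<Sum>s\<in>S. C s * (LINT x:A|M. e s x))"
    using set_integral_finite_combination(2)[of S M A e C] int
    by (simp add: set_lebesgue_integral_def)
  finally show ?thesis .
qed

lemma nn_integral_trig_sum_interval:
  fixes F :: "real \<Rightarrow> real" and \<tau> :: "'s \<Rightarrow> int"
  assumes "finite S" "\<And>t. 0 \<le> F t"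
    and "\<And>t. complex_of_real (F t) = (\<Sum>s\<in>S. C s * cis (2 * pi * (t * of_int (\<tau> s))))"
  shows "(\<integral>\<^sup>+t\<in>{0..1}. ennreal (F t) \<partial>lebesgue) = ennreal (Re (\<Sum>s\<in>S. C s * of_bool (\<tau> s = 0)))"
proof -
  have "set_integrable lborel {0..1} (\<lambda>t. cis (2 * pi * (t * of_int (\<tau> s))))" for s
    by (intro borel_integrable_atLeastAtMost' continuous_intros)
  from nn_set_integral_finite_sum[OF assms(1,2) this assms(3)] show ?thesis
    by (simp add: nn_integral_completion integral_character_unit_interval)
qed

lemma set_integrable_character_unit_cube:
  "set_integrable lborel (cbox 0 1) (\<lambda>x. cis (2 * pi * (x \<bullet> zvec k)))"
  unfolding set_integrable_def by (intro borel_integrable_compact continuous_intros) auto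

lemma nn_integral_trig_sum_cube:
  fixes F :: "real ^ 'd::finite \<Rightarrow> real" and \<beta> :: "'s \<Rightarrow> int ^ 'd"
  assumes "finite S" "\<And>x. 0 \<le> F x"
    and "\<And>x. complex_of_real (F x) = (\<Sum>s\<in>S. C s * cis (2 * pi * (x \<bullet> zvec (\<beta> s))))"
  shows "(\<integral>\<^sup>+x\<in>cbox 0 1. ennreal (F x) \<partial>lebesgue) = ennreal (Re (\<Sum>s\<in>S. C s * of_bool (\<beta> s = 0)))"
  using nn_set_integral_finite_sum[OF assms(1,2) set_integrable_character_unit_cube assms(3)]
  by (simp add: nn_integral_completion integral_character_unit_cube)

text \<open>
  The inner integral is again a nonnegative trigonometric sum, now in \<open>t\<close> alone, which consists of
  the terms of zero spatial frequency.
\<close>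
lemma nn_integral_trig_sum_spacetime:
  fixes F :: "real ^ 'd::finite \<Rightarrow> real \<Rightarrow> real" and \<beta> :: "'s \<Rightarrow> int ^ 'd" and \<tau> :: "'s \<Rightarrow> int"
  assumes "finite S" and nonneg: "\<And>x t. 0 \<le> F x t"
    and F: "\<And>x t. complex_of_real (F x t) =
       (\<Sum>s\<in>S. C s * cis (2 * pi * (x \<bullet> zvec (\<beta> s) + t * of_int (\<tau> s))))"
  shows "(\<integral>\<^sup>+t\<in>{0..1}. (\<integral>\<^sup>+x\<in>cbox 0 1. ennreal (F x t) \<partial>lebesgue) \<partial>lebesgue)
     = ennreal (Re (\<Sum>s\<in>S. C s * of_bool (\<beta> s = 0 \<and> \<tau> s = 0)))"
proof -
  define G where "G t = (LINT x:cbox 0 1|lborel. F x t)" for t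
  have inner: "(\<integral>\<^sup>+x\<in>cbox 0 1. ennreal (F x t) \<partial>lebesgue) = ennreal (G t)"
    and G: "complex_of_real (G t) = (\<Sum>s\<in>S. (C s * of_bool (\<beta> s = 0)) * cis (2 * pi * (t * of_int (\<tau> s))))"
    and "0 \<le> G t" for t
  proof -
    have *: "complex_of_real (F x t) = (\<Sum>s\<in>S. (C s * cis (2 * pi * (t * of_int (\<tau> s)))) * cis (2 * pi * (x \<bullet> zvec (\<beta> s))))" for x
      unfolding F by (intro sum.cong refl) (simp add: cis_mult algebra_simps)
    have "complex_of_real (G t) = (LINT x:cbox 0 1|lborel. complex_of_real (F x t))"
      by (simp add: G_def set_integral_complex_of_real)
    also have "\<dots> = (\<Sum>s\<in>S. (C s * cis (2 * pi * (t * of_int (\<tau> s)))) * (LINT x:cbox 0 1|lborel. cis (2 * pi * (x \<bullet> zvec (\<beta> s)))))"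
      unfolding * by (rule set_integral_finite_combination) (rule set_integrable_character_unit_cube)
    finally show **: "complex_of_real (G t) = (\<Sum>s\<in>S. (C s * of_bool (\<beta> s = 0)) * cis (2 * pi * (t * of_int (\<tau> s))))"
      unfolding integral_character_unit_cube by (simp only: mult_ac)
    show "(\<integral>\<^sup>+x\<in>cbox 0 1. ennreal (F x t) \<partial>lebesgue) = ennreal (G t)"
      unfolding nn_integral_trig_sum_cube[OF assms(1) nonneg *]
      by (simp add: ** [THEN arg_cong[of _ _ Re], simplified Re_complex_of_real] mult_ac)
    show "0 \<le> G t"
      unfolding G_def by (simp add: set_lebesgue_integral_def nonneg)
  qed
  show ?thesis
    unfolding inner nn_integral_trig_sum_interval[OF assms(1) \<open>\<And>t. 0 \<le> G t\<close> G]
    by (simp add: of_bool_conj mult.assoc)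
qed

section \<open>Fourier coefficients, Parseval and the comparison of the two inequalities\<close>

lemma zvec_0 [simp]: "zvec 0 = 0"
  and zvec_add: "zvec (k + l) = zvec k + zvec l"
  and zvec_diff: "zvec (k - l) = zvec k - zvec l"
  and zvec_scale: "zvec (c *s k) = of_int c *\<^sub>R zvec k"
  by (simp_all add: zvec_def vec_eq_iff)

lemma zvec_sum: "zvec (\<Sum>i\<in>A. f i) = (\<Sum>i\<in>A. zvec (f i))"
  by (induction A rule: infinite_finite_induct) (simp_all add: zvec_add)

lemma fourier_trig_sum:
  assumes "finite F"
  shows "fourier (\<lambda>x. \<Sum>k\<in>F. a k * cis (2 * pi * (x \<bullet> zvec k))) l = (if l \<in> F then a l else 0)"
proof -
  have eq: "(\<Sum>k\<in>F. a k * cis (2 * pi * (x \<bullet> zvec k))) * cis (- 2 * pi * (x \<bullet> zvec l))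
      = (\<Sum>k\<in>F. a k * cis (2 * pi * (x \<bullet> zvec (k - l))))" for x
    unfolding sum_distrib_right
    by (intro sum.cong refl) (simp add: mult.assoc cis_mult zvec_diff algebra_simps)
  have int: "set_integrable lborel (cbox 0 1) (\<lambda>x. \<Sum>k\<in>F. a k * cis (2 * pi * (x \<bullet> zvec (k - l))))"
    by (rule set_integrable_finite_combination) (rule set_integrable_character_unit_cube)
  have "fourier (\<lambda>x. \<Sum>k\<in>F. a k * cis (2 * pi * (x \<bullet> zvec k))) l
      = (LINT x:cbox 0 1|lebesgue. \<Sum>k\<in>F. a k * cis (2 * pi * (x \<bullet> zvec (k - l))))"
    unfolding fourier_def eq ..
  also have "\<dots> = (LINT x:cbox 0 1|lborel. \<Sum>k\<in>F. a k * cis (2 * pi * (x \<bullet> zvec (k - l))))"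
    using borel_measurable_integrable[OF int[unfolded set_integrable_def]]
    unfolding set_lebesgue_integral_def by (rule integral_completion)
  also have "\<dots> = (\<Sum>k\<in>F. a k * of_bool (k = l))"
    by (simp add: set_integral_finite_combination set_integrable_character_unit_cube
        integral_character_unit_cube)
  also have "\<dots> = (if l \<in> F then a l else 0)"
    using assms by (simp add: of_bool_def if_distrib sum.delta cong: if_cong)
  finally show ?thesis .
qed

lemma trig_poly_expansion:
  assumes "u0 \<in> trig_polys"
  shows finite_spectrum: "finite (spectrum u0)"
    and "u0 x = (\<Sum>k\<in>spectrum u0. fourier u0 k * cis (2 * pi * (x \<bullet> zvec k)))"
proof -
  obtain F a where F: "finite F" and u0: "u0 = (\<lambda>x. \<Sum>k\<in>F. a k * cis (2 * pi * (x \<bullet> zvec k)))"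
    using assms by (auto simp: trig_polys_def)
  have a: "fourier u0 k = (if k \<in> F then a k else 0)" for k
    unfolding u0 by (rule fourier_trig_sum[OF F])
  then have sub: "spectrum u0 \<subseteq> F"
    by (auto simp: spectrum_def)
  with F show "finite (spectrum u0)"
    by (rule finite_subset[rotated])
  have "(\<Sum>k\<in>spectrum u0. fourier u0 k * cis (2 * pi * (x \<bullet> zvec k)))
      = (\<Sum>k\<in>F. fourier u0 k * cis (2 * pi * (x \<bullet> zvec k)))"
    by (rule sum.mono_neutral_left[OF F sub]) (auto simp: spectrum_def)
  then show "u0 x = (\<Sum>k\<in>spectrum u0. fourier u0 k * cis (2 * pi * (x \<bullet> zvec k)))"
    by (simp add: a) (simp add: u0)
qed

lemma parseval_trig_poly:
  assumes "u0 \<in> trig_polys"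
  shows "L2_norm_sq u0 = (\<Sum>k\<in>spectrum u0. ennreal ((cmod (fourier u0 k))\<^sup>2))"
proof -
  let ?K = "spectrum u0" and ?a = "fourier u0"
  have fin: "finite ?K" by (rule finite_spectrum[OF assms])
  have "complex_of_real ((cmod (u0 x))\<^sup>2) = (\<Sum>(k, l)\<in>?K \<times> ?K. ?a k * cnj (?a l) *
     cis (2 * pi * (x \<bullet> zvec (k - l))))" for x
  proof -
    have "complex_of_real ((cmod (u0 x))\<^sup>2) =
      (\<Sum>k\<in>?K. \<Sum>l\<in>?K. (?a k * cis (2 * pi * (x \<bullet> zvec k))) * cnj (?a l * cis (2 * pi * (x \<bullet> zvec l))))"
      unfolding complex_norm_square
      by (subst (1 2) trig_poly_expansion(2)[OF assms]) (simp only: cnj_sum sum_product)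
    also have "\<dots> = (\<Sum>k\<in>?K. \<Sum>l\<in>?K. ?a k * cnj (?a l) * cis (2 * pi * (x \<bullet> zvec (k - l))))"
    proof (intro sum.cong refl)
      fix k l
      have e: "cis (2 * pi * (x \<bullet> zvec k)) * cnj (cis (2 * pi * (x \<bullet> zvec l))) = cis (2 * pi * (x \<bullet> zvec (k - l)))"
        by (simp add: cis_cnj cis_mult zvec_diff algebra_simps)
      then show "(?a k * cis (2 * pi * (x \<bullet> zvec k))) * cnj (?a l * cis (2 * pi * (x \<bullet> zvec l)))
        = ?a k * cnj (?a l) * cis (2 * pi * (x \<bullet> zvec (k - l)))"
        unfolding e[symmetric] complex_cnj_mult by (simp only: mult_ac)
    qed
    finally show ?thesis
      by (simp add: sum.cartesian_product)
  qed
  then have "L2_norm_sq u0 = ennreal (Re (\<Sum>s\<in>?K \<times> ?K. (?a (fst s) * cnj (?a (snd s))) * of_bool (fst s - snd s = 0)))"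
    unfolding L2_norm_sq_def using fin
    by (intro nn_integral_trig_sum_cube) (auto simp: case_prod_beta)
  also have "(\<Sum>s\<in>?K \<times> ?K. (?a (fst s) * cnj (?a (snd s))) * of_bool (fst s - snd s = 0))
    = (\<Sum>k\<in>?K. \<Sum>l\<in>?K. ?a k * cnj (?a l) * of_bool (k = l))"
    by (simp add: sum.cartesian_product case_prod_beta)
  also have "\<dots> = (\<Sum>k\<in>?K. complex_of_real ((cmod (?a k))\<^sup>2))"
    unfolding complex_norm_square using fin
    by (intro sum.cong refl) (simp add: of_bool_def if_distrib cong: if_cong)
  finally show ?thesis
    by (simp flip: of_real_sum)
qed

text \<open>
  Bounding each supremum on the right of Stein's inequality by the supremum over the whole
  spectrum leaves the sum of the squared coefficients, which Parseval turns into the squared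
  \<open>L\<^sup>2\<close> norm. Hence the Stein constants dominate the Mizohata-Takeuchi constants: lower bounds are
  only needed for the latter and upper bounds only for the former.
\<close>
lemma stein_ineq_imp_mt_ineq:
  assumes "u0 \<in> trig_polys" and "stein_ineq C w u0"
  shows "mt_ineq C w u0"
proof -
  let ?S = "SUP (x, k)\<in>UNIV \<times> spectrum u0. rho_star w x k"
  have le: "(SUP x. rho_star w x k) \<le> ?S" if "k \<in> spectrum u0" for k
    using that by (intro SUP_least SUP_upper2[where i = "(_, k)"]) auto
  have "weighted_energy w u0 \<le> C * (\<Sum>k\<in>spectrum u0. ennreal ((cmod (fourier u0 k))\<^sup>2) * (SUP x. rho_star w x k))"
    using assms(2) by (simp add: stein_ineq_def)
  also have "\<dots> \<le> C * (\<Sum>k\<in>spectrum u0. ennreal ((cmod (fourier u0 k))\<^sup>2) * ?S)"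
    by (intro mult_left_mono sum_mono le) auto
  also have "\<dots> = C * ?S * L2_norm_sq u0"
    unfolding parseval_trig_poly[OF assms(1)] sum_distrib_right[symmetric] by (simp only: mult_ac)
  finally show ?thesis
    by (simp add: mt_ineq_def)
qed

lemma mt_const_le_stein_const: "mt_const TYPE('d::finite) N \<le> stein_const TYPE('d) N"
  unfolding mt_const_def stein_const_def
  by (rule Inf_superset_mono) (auto intro: stein_ineq_imp_mt_ineq)

lemma mt_const_card_le_stein_const_card:
  "mt_const_card TYPE('d::finite) n \<le> stein_const_card TYPE('d) n"
  unfolding mt_const_card_def stein_const_card_def
  by (rule Inf_superset_mono) (auto intro: stein_ineq_imp_mt_ineq)

section \<open>Averages along lines of periodic functions\<close>

text \<open>
  Unlike the closed cube, the half-open one tiles space exactly by its integer translates, while it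
  differs from the closed one by a null set.
\<close>
definition half_open_cube :: "(real ^ 'd::finite) set" where
  "half_open_cube = {x. \<forall>i. 0 \<le> x $ i \<and> x $ i < 1}"

definition frac_vec :: "real ^ 'd::finite \<Rightarrow> real ^ 'd" where
  "frac_vec x = (\<chi> i. frac (x $ i))"

lemma half_open_cube_measurable [measurable]: "half_open_cube \<in> sets borel"
proof -
  have "half_open_cube = (\<Inter>i. {x::real^'d. 0 \<le> x $ i} \<inter> {x. x $ i < 1})"
    by (auto simp: half_open_cube_def)
  also have "\<dots> \<in> sets borel"
    by (intro sets.finite_INT sets.Int borel_closed borel_open closed_Collect_le open_Collect_less
        continuous_intros) auto
  finally show ?thesis .
qed

lemma frac_vec_measurable [measurable]: "frac_vec \<in> borel_measurable borel"
proof -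
  have "(\<lambda>x. frac_vec x \<bullet> b) \<in> borel_measurable borel" if b: "b \<in> Basis" for b :: "real^'d"
  proof -
    obtain i where "b = axis i 1"
      using b by (auto simp: Basis_vec_def)
    then have "(\<lambda>x. frac_vec x \<bullet> b) = (\<lambda>x. x $ i - of_int \<lfloor>x $ i\<rfloor>)"
      by (simp add: frac_vec_def inner_axis frac_def)
    then show ?thesis
      using measurable_compose[OF borel_measurable_nth borel_measurable_real_floor] by simp
  qed
  then show ?thesis
    by (subst borel_measurable_euclidean_space) auto
qed

lemma frac_vec_add_zvec [simp]: "frac_vec (x + zvec k) = frac_vec x"
  by (simp add: frac_vec_def zvec_def frac_def vec_eq_iff)

lemma frac_vec_eq: "frac_vec x = x + zvec (\<chi> i. - \<lfloor>x $ i\<rfloor>)"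
  by (simp add: frac_vec_def zvec_def frac_def vec_eq_iff)

lemma frac_vec_half_open_cube: "x \<in> half_open_cube \<Longrightarrow> frac_vec x = x"
  by (simp add: half_open_cube_def frac_vec_def vec_eq_iff frac_eq)

lemma half_open_cube_subset: "half_open_cube \<subseteq> cbox (0::real^'d::finite) 1"
  and box_subset_half_open_cube: "box (0::real^'d) 1 \<subseteq> half_open_cube"
  by (auto simp: half_open_cube_def mem_box_cart less_imp_le)

lemma frac_vec_in_cbox: "frac_vec x \<in> cbox 0 1"
  by (auto simp: frac_vec_def mem_box_cart frac_lt_1 less_imp_le)

lemma AE_cbox_iff_half_open_cube:
  "AE x in lborel. x \<in> cbox (0::real^'d::finite) 1 \<longleftrightarrow> x \<in> half_open_cube"
proof (rule AE_I')
  have "emeasure lborel (cbox (0::real^'d) 1 - box 0 1) = 0"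
    using box_subset_cbox[of "0::real^'d" 1]
    by (subst emeasure_Diff) (auto simp: emeasure_lborel_box_eq emeasure_lborel_cbox_eq)
  then show "cbox (0::real^'d) 1 - box 0 1 \<in> null_sets lborel"
    by (simp add: null_sets_def)
qed (use half_open_cube_subset box_subset_half_open_cube in auto)

lemma emeasure_half_open_cube: "emeasure lborel (half_open_cube :: (real^'d::finite) set) = 1"
proof -
  have "emeasure lborel (half_open_cube :: (real^'d::finite) set) = emeasure lborel (cbox (0::real^'d) 1)"
    using AE_cbox_iff_half_open_cube[where 'd='d] by (intro emeasure_eq_AE) auto
  then show ?thesis
    by (simp add: emeasure_lborel_cbox_eq one_inner_Basis)
qed

lemma half_open_cube_tiles:
  fixes x :: "real ^ 'd::finite"
  shows "(\<integral>\<^sup>+k. indicator half_open_cube (x + zvec k) \<partial>count_space UNIV) = 1"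
proof -
  \<comment> \<open>The unique integer shift that brings \<open>x\<close> into the cube.\<close>
  define k0 :: "int^'d" where "k0 = (\<chi> i. - \<lfloor>x $ i\<rfloor>)"
  have "x + zvec k \<in> half_open_cube \<longleftrightarrow> k = k0" for k
  proof -
    have "0 \<le> x $ i + of_int (k $ i) \<and> x $ i + of_int (k $ i) < 1 \<longleftrightarrow> k $ i = - \<lfloor>x $ i\<rfloor>" for i
      by linarith
    then show ?thesis
      by (simp add: half_open_cube_def zvec_def k0_def vec_eq_iff)
  qed
  then have "(\<integral>\<^sup>+k. indicator half_open_cube (x + zvec k) \<partial>count_space UNIV)
     = (\<integral>\<^sup>+k. indicator {k0} k \<partial>count_space UNIV)"
    by (intro nn_integral_cong) (auto simp: indicator_def)
  then show ?thesis by simp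
qed

lemma nn_integral_lborel_translate:
  fixes f :: "'a::euclidean_space \<Rightarrow> ennreal"
  assumes [measurable]: "f \<in> borel_measurable borel"
  shows "(\<integral>\<^sup>+x. f (x + c) \<partial>lborel) = (\<integral>\<^sup>+x. f x \<partial>lborel)"
  by (subst (2) lborel_distr_plus[of c, symmetric]) (simp add: nn_integral_distr add.commute)

text \<open>
  Cutting the translated cube along the integer tiling and moving each piece back into the
  fundamental cube rearranges it, up to integer shifts, into that cube.
\<close>
lemma nn_integral_periodic_translate:
  fixes W :: "real ^ 'd::finite \<Rightarrow> ennreal"
  assumes [measurable]: "W \<in> borel_measurable borel" and per: "\<And>x k. W (x + zvec k) = W x"
  shows "(\<integral>\<^sup>+x\<in>half_open_cube. W (x + s) \<partial>lborel) = (\<integral>\<^sup>+x\<in>half_open_cube. W x \<partial>lborel)"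
proof -
  let ?Q = "half_open_cube :: (real^'d) set"
  let ?I = "\<lambda>x. indicator ?Q x :: ennreal"
  have fubini: "(\<integral>\<^sup>+x. (\<integral>\<^sup>+k. f k x \<partial>count_space UNIV) \<partial>lborel) = (\<integral>\<^sup>+k. (\<integral>\<^sup>+x. f k x \<partial>lborel) \<partial>count_space UNIV)"
    if "\<And>k. f k \<in> borel_measurable borel" for f :: "int^'d \<Rightarrow> real^'d \<Rightarrow> ennreal"
    using that by (intro nn_integral_count_space_nn_integral) auto
  have one: "(\<integral>\<^sup>+k. ?I (y + zvec (- k)) \<partial>count_space UNIV) = 1" for y :: "real^'d"
    using nn_integral_bij_count_space[of uminus "UNIV :: (int^'d) set" UNIV "\<lambda>k. ?I (y + zvec k)"]
    by (simp add: half_open_cube_tiles bij_uminus)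
  have "(\<integral>\<^sup>+x\<in>?Q. W (x + s) \<partial>lborel) = (\<integral>\<^sup>+x. W (x + s) * ?I ((x + s) - s) \<partial>lborel)"
    by simp
  also have "\<dots> = (\<integral>\<^sup>+x. W x * ?I (x - s) \<partial>lborel)"
    by (rule nn_integral_lborel_translate[where f = "\<lambda>x. W x * ?I (x - s)"]) measurable
  also have "\<dots> = (\<integral>\<^sup>+x. (\<integral>\<^sup>+k. W x * ?I (x - s) * ?I (x + zvec k) \<partial>count_space UNIV) \<partial>lborel)"
    by (simp add: nn_integral_cmult half_open_cube_tiles)
  also have "\<dots> = (\<integral>\<^sup>+k. (\<integral>\<^sup>+x. W x * ?I (x - s) * ?I (x + zvec k) \<partial>lborel) \<partial>count_space UNIV)"
    by (rule fubini) measurable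
  also have "\<dots> = (\<integral>\<^sup>+k. (\<integral>\<^sup>+x. W x * ?I x * ?I ((x - s) + zvec (- k)) \<partial>lborel) \<partial>count_space UNIV)"
  proof (rule nn_integral_cong)
    fix k :: "int^'d"
    have neg: "zvec (- k) = - zvec k"
      by (simp add: zvec_def vec_eq_iff)
    have "W (x + zvec k) * ?I (x + zvec k) * ?I ((x + zvec k - s) + zvec (- k)) = W x * ?I (x - s) * ?I (x + zvec k)" for x
      by (simp add: per neg algebra_simps)
    moreover have "(\<integral>\<^sup>+x. W (x + zvec k) * ?I (x + zvec k) * ?I ((x + zvec k - s) + zvec (- k)) \<partial>lborel)
      = (\<integral>\<^sup>+x. W x * ?I x * ?I ((x - s) + zvec (- k)) \<partial>lborel)"
      by (rule nn_integral_lborel_translate[where f = "\<lambda>x. W x * ?I x * ?I ((x - s) + zvec (- k))"]) measurable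
    ultimately show "(\<integral>\<^sup>+x. W x * ?I (x - s) * ?I (x + zvec k) \<partial>lborel)
      = (\<integral>\<^sup>+x. W x * ?I x * ?I ((x - s) + zvec (- k)) \<partial>lborel)"
      by simp
  qed
  also have "\<dots> = (\<integral>\<^sup>+x. (\<integral>\<^sup>+k. W x * ?I x * ?I ((x - s) + zvec (- k)) \<partial>count_space UNIV) \<partial>lborel)"
    by (rule fubini[symmetric]) measurable
  also have "\<dots> = (\<integral>\<^sup>+x. W x * ?I x * (\<integral>\<^sup>+k. ?I ((x - s) + zvec (- k)) \<partial>count_space UNIV) \<partial>lborel)"
    by (simp add: nn_integral_cmult)
  also have "\<dots> = (\<integral>\<^sup>+x\<in>?Q. W x \<partial>lborel)"
    by (simp add: one)
  finally show ?thesis .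
qed

text \<open>
  By Tonelli the integral over \<open>x\<close> may be taken first, and for fixed \<open>t\<close> the slanted line only
  translates the periodic function \<open>g(\<cdot>, t)\<close>.
\<close>
lemma nn_integral_lines_periodic:
  fixes g :: "(real ^ 'd::finite) \<times> real \<Rightarrow> ennreal"
  assumes [measurable]: "g \<in> borel_measurable borel" and per: "\<And>x k t. g (x + zvec k, t) = g (x, t)"
  shows "(\<integral>\<^sup>+x\<in>half_open_cube. (\<integral>\<^sup>+t\<in>{0..1}. g (x - (2 * t) *\<^sub>R zvec k, t) \<partial>lborel) \<partial>lborel)
     = (\<integral>\<^sup>+t\<in>{0..1}. (\<integral>\<^sup>+x\<in>half_open_cube. g (x, t) \<partial>lborel) \<partial>lborel)"
proof -
  let ?Q = "half_open_cube :: (real^'d) set"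
  have meas_line: "(\<lambda>(x, t). g (x - (2 * t) *\<^sub>R zvec k, t)) \<in> borel_measurable (borel \<Otimes>\<^sub>M borel)"
    by measurable
  note [measurable] = meas_line
  have "(\<integral>\<^sup>+x\<in>?Q. (\<integral>\<^sup>+t\<in>{0..1}. g (x - (2 * t) *\<^sub>R zvec k, t) \<partial>lborel) \<partial>lborel)
    = (\<integral>\<^sup>+x. (\<integral>\<^sup>+t. g (x - (2 * t) *\<^sub>R zvec k, t) * indicator {0..1} t * indicator ?Q x \<partial>lborel) \<partial>lborel)"
    by (subst nn_integral_multc) auto
  also have "\<dots> = (\<integral>\<^sup>+t. (\<integral>\<^sup>+x. g (x - (2 * t) *\<^sub>R zvec k, t) * indicator {0..1} t * indicator ?Q x \<partial>lborel) \<partial>lborel)"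
    by (rule lborel_pair.Fubini'[symmetric]) measurable
  also have "\<dots> = (\<integral>\<^sup>+t\<in>{0..1}. (\<integral>\<^sup>+x\<in>?Q. g (x - (2 * t) *\<^sub>R zvec k, t) \<partial>lborel) \<partial>lborel)"
    by (intro nn_integral_cong, subst nn_integral_multc[symmetric]) (auto simp: mult_ac)
  also have "\<dots> = (\<integral>\<^sup>+t\<in>{0..1}. (\<integral>\<^sup>+x\<in>?Q. g (x, t) \<partial>lborel) \<partial>lborel)"
    using nn_integral_periodic_translate[of "\<lambda>x. g (x, _)" "- (2 * _) *\<^sub>R zvec k"] per
    by simp
  finally show ?thesis .
qed

section \<open>The upper bound by the number of frequencies\<close>

text \<open>
  Weights are merely Lebesgue measurable, so \<open>nn_integral_lines_periodic\<close> cannot be applied to them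
  directly. It applies, however, to a periodic Borel function \<open>h\<close> that agrees with \<open>w\<close> outside a
  periodic Borel null set, and also to the indicator function of this null set, where it shows that
  almost every line of each direction \<open>k\<close>, and almost every time slice, meets that set in a null set.
\<close>
lemma weight_borel_representative:
  fixes w :: "(real ^ 'd::finite) \<times> real \<Rightarrow> real"
  assumes w: "w \<in> weights"
  obtains h :: "(real ^ 'd) \<times> real \<Rightarrow> ennreal" where
    "h \<in> borel_measurable borel" "\<And>x k t. h (x + zvec k, t) = h (x, t)"
    "\<And>k. AE x in lborel. x \<in> half_open_cube \<longrightarrow>
      (AE t in lborel. t \<in> {0..1} \<longrightarrow> ennreal (w (x - (2 * t) *\<^sub>R zvec k, t)) = h (x - (2 * t) *\<^sub>R zvec k, t))"
    "AE t in lborel. t \<in> {0..1} \<longrightarrow>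
      (AE x in lborel. x \<in> half_open_cube \<longrightarrow> ennreal (w (x, t)) = h (x, t))"
proof -
  let ?cell = "cbox 0 1 \<times> {0..1} :: ((real^'d) \<times> real) set"
  let ?Q = "half_open_cube :: (real^'d) set"
  have wper: "w (x + zvec k, t) = w (x, t)" for x k t
  proof -
    have "w (x + zvec k, t + real_of_int 0) = w (x, t)"
      using w unfolding weights_def by blast
    then show ?thesis by simp
  qed
  have "set_integrable lebesgue ?cell w"
    using w by (simp add: weights_def)
  then have "(\<lambda>z. indicat_real ?cell z *\<^sub>R w z) \<in> borel_measurable lebesgue"
    unfolding set_integrable_def by (rule borel_measurable_integrable)
  then have "(\<lambda>z. ennreal (indicat_real ?cell z *\<^sub>R w z)) \<in> borel_measurable lebesgue"
    by measurable
  from completion_ex_borel_measurable[OF this] obtain g' where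
    g' [measurable]: "g' \<in> borel_measurable lborel"
    and "AE z in lborel. ennreal (indicat_real ?cell z *\<^sub>R w z) = g' z"
    by blast
  then obtain N where N: "N \<in> null_sets lborel"
    and sub: "{z. ennreal (indicat_real ?cell z *\<^sub>R w z) \<noteq> g' z} \<subseteq> N"
    by (auto simp: eventually_ae_filter)
  then have [measurable]: "N \<in> sets borel"
    by auto
  \<comment> \<open>Periodic extensions in \<open>x\<close> of the Borel function and of the exceptional null set.\<close>
  define h where "h = (\<lambda>(x, t). g' (frac_vec x, t))"
  define z :: "(real^'d) \<times> real \<Rightarrow> ennreal" where "z = (\<lambda>(x, t). indicator N (frac_vec x, t))"
  have [measurable]: "g' \<in> borel_measurable borel"
    using g' by simp
  have map: "(\<lambda>(x, t). (frac_vec x, t)) \<in> (borel \<Otimes>\<^sub>M borel) \<rightarrow>\<^sub>M (borel :: ((real^'d) \<times> real) measure)"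
    unfolding borel_prod[symmetric] by measurable
  have h: "h \<in> borel_measurable borel"
    using measurable_compose[OF map \<open>g' \<in> borel_measurable borel\<close>]
    by (simp add: h_def borel_prod case_prod_beta')
  have "(\<lambda>p. indicator N p :: ennreal) \<in> borel_measurable borel"
    by measurable
  from measurable_compose[OF map this] have z [measurable]: "z \<in> borel_measurable borel"
    by (simp add: z_def borel_prod case_prod_beta')
  have zper: "z (x + zvec k, t) = z (x, t)" for x k t
    by (simp add: z_def)
  have z_le: "z (x, t) * indicator ?Q x \<le> indicator N (x, t)" for x t
    by (auto simp: z_def frac_vec_half_open_cube split: split_indicator)
  have agree: "ennreal (w (x, t)) = h (x, t)" if "t \<in> {0..1}" "z (x, t) = 0" for x t
  proof -
    have "(frac_vec x, t) \<notin> N" and "(frac_vec x, t) \<in> ?cell"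
      using that by (auto simp: z_def frac_vec_in_cbox split: split_indicator_asm)
    moreover from this have "ennreal (indicat_real ?cell (frac_vec x, t) *\<^sub>R w (frac_vec x, t)) = g' (frac_vec x, t)"
      using sub by blast
    ultimately have "ennreal (w (frac_vec x, t)) = g' (frac_vec x, t)"
      by simp
    then show ?thesis
      by (simp add: h_def) (metis frac_vec_eq wper)
  qed
  have [measurable]: "(\<lambda>(x, t). z (x - (2 * t) *\<^sub>R zvec k, t)) \<in> borel_measurable (borel \<Otimes>\<^sub>M borel)" for k
    by measurable
  have "(\<integral>\<^sup>+t\<in>{0..1}. (\<integral>\<^sup>+x\<in>?Q. z (x, t) \<partial>lborel) \<partial>lborel) \<le> (\<integral>\<^sup>+t. (\<integral>\<^sup>+x. indicator N (x, t) \<partial>lborel) \<partial>lborel)"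
  proof (rule nn_integral_mono)
    fix t :: real
    have "(\<integral>\<^sup>+x\<in>?Q. z (x, t) \<partial>lborel) \<le> (\<integral>\<^sup>+x. indicator N (x, t) \<partial>lborel)"
      by (rule nn_integral_mono) (rule z_le)
    then show "(\<integral>\<^sup>+x\<in>?Q. z (x, t) \<partial>lborel) * indicator {0..1} t \<le> (\<integral>\<^sup>+x. indicator N (x, t) \<partial>lborel)"
      by (auto split: split_indicator)
  qed
  also have "\<dots> = emeasure (lborel \<Otimes>\<^sub>M lborel) N"
    by (subst lborel_pair.nn_integral_snd) (simp_all add: lborel_prod)
  also have "\<dots> = 0"
    using N by (simp add: lborel_prod null_sets_def)
  finally have z0: "(\<integral>\<^sup>+t\<in>{0..1}. (\<integral>\<^sup>+x\<in>?Q. z (x, t) \<partial>lborel) \<partial>lborel) = 0"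
    by simp
  have lines: "AE x in lborel. x \<in> ?Q \<longrightarrow>
      (AE t in lborel. t \<in> {0..1} \<longrightarrow> ennreal (w (x - (2 * t) *\<^sub>R zvec k, t)) = h (x - (2 * t) *\<^sub>R zvec k, t))" for k
  proof -
    have "(\<integral>\<^sup>+x\<in>?Q. (\<integral>\<^sup>+t\<in>{0..1}. z (x - (2 * t) *\<^sub>R zvec k, t) \<partial>lborel) \<partial>lborel) = 0"
      using nn_integral_lines_periodic[OF z zper] z0 by simp
    then have "AE x in lborel. (\<integral>\<^sup>+t\<in>{0..1}. z (x - (2 * t) *\<^sub>R zvec k, t) \<partial>lborel) * indicator ?Q x = 0"
      by (subst (asm) nn_integral_0_iff_AE) auto
    then show ?thesis
    proof (eventually_elim, intro impI)
      fix x assume "(\<integral>\<^sup>+t\<in>{0..1}. z (x - (2 * t) *\<^sub>R zvec k, t) \<partial>lborel) * indicator ?Q x = 0" "x \<in> ?Q"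
      then have "(\<integral>\<^sup>+t\<in>{0..1}. z (x - (2 * t) *\<^sub>R zvec k, t) \<partial>lborel) = 0"
        by simp
      then have "AE t in lborel. z (x - (2 * t) *\<^sub>R zvec k, t) * indicator {0..1} t = 0"
        by (subst (asm) nn_integral_0_iff_AE) auto
      then show "AE t in lborel. t \<in> {0..1} \<longrightarrow> ennreal (w (x - (2 * t) *\<^sub>R zvec k, t)) = h (x - (2 * t) *\<^sub>R zvec k, t)"
        by (eventually_elim, intro impI agree) (auto split: split_indicator_asm)
    qed
  qed
  have slices: "AE t in lborel. t \<in> {0..1} \<longrightarrow>
      (AE x in lborel. x \<in> ?Q \<longrightarrow> ennreal (w (x, t)) = h (x, t))"
  proof -
    have "AE t in lborel. (\<integral>\<^sup>+x\<in>?Q. z (x, t) \<partial>lborel) * indicator {0..1} t = 0"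
      using z0 by (subst (asm) nn_integral_0_iff_AE) auto
    then show ?thesis
    proof (eventually_elim, intro impI)
      fix t :: real assume "(\<integral>\<^sup>+x\<in>?Q. z (x, t) \<partial>lborel) * indicator {0..1} t = 0" and t: "t \<in> {0..1}"
      then have "(\<integral>\<^sup>+x\<in>?Q. z (x, t) \<partial>lborel) = 0"
        by simp
      then have "AE x in lborel. z (x, t) * indicator ?Q x = 0"
        by (subst (asm) nn_integral_0_iff_AE) auto
      then show "AE x in lborel. x \<in> ?Q \<longrightarrow> ennreal (w (x, t)) = h (x, t)"
        by (eventually_elim, intro impI agree) (use t in \<open>auto split: split_indicator_asm\<close>)
    qed
  qed
  show thesis
    by (rule that[OF h _ lines slices]) (simp add: h_def)
qed

text \<open>
  The total mass of \<open>w\<close> is the average over \<open>x\<close> of the line integrals in the direction \<open>k\<close>, and an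
  average is at most a supremum.  The factor \<open>A\<close> is kept under the integral because
  it can only be pulled out once \<open>w\<close> has been replaced by a Borel function.
\<close>
lemma nn_integral_weight_le_SUP_rho_star:
  fixes w :: "(real ^ 'd::finite) \<times> real \<Rightarrow> real"
  assumes w: "w \<in> weights"
  shows "(\<integral>\<^sup>+t\<in>{0..1}. (\<integral>\<^sup>+x\<in>cbox 0 1. A * ennreal (w (x, t)) \<partial>lebesgue) \<partial>lebesgue)
    \<le> A * (SUP x. rho_star w x k)"
proof -
  let ?Q = "half_open_cube :: (real^'d) set"
  obtain h :: "(real ^ 'd) \<times> real \<Rightarrow> ennreal" where
    h [measurable]: "h \<in> borel_measurable borel" and hper: "\<And>x k t. h (x + zvec k, t) = h (x, t)"
    and lines: "\<And>k. AE x in lborel. x \<in> ?Q \<longrightarrow>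
      (AE t in lborel. t \<in> {0..1} \<longrightarrow> ennreal (w (x - (2 * t) *\<^sub>R zvec k, t)) = h (x - (2 * t) *\<^sub>R zvec k, t))"
    and slices: "AE t in lborel. t \<in> {0..1} \<longrightarrow>
      (AE x in lborel. x \<in> ?Q \<longrightarrow> ennreal (w (x, t)) = h (x, t))"
    using weight_borel_representative[OF w] by blast
  have "(\<integral>\<^sup>+t\<in>{0..1}. (\<integral>\<^sup>+x\<in>cbox 0 1. A * ennreal (w (x, t)) \<partial>lebesgue) \<partial>lebesgue)
      = (\<integral>\<^sup>+t\<in>{0..1}. (\<integral>\<^sup>+x\<in>?Q. A * h (x, t) \<partial>lborel) \<partial>lborel)"
    unfolding nn_integral_completion
  proof (rule nn_integral_cong_AE, rule AE_mp[OF slices], intro AE_I2 impI)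
    fix t :: real
    assume t: "t \<in> {0..1} \<longrightarrow> (AE x in lborel. x \<in> ?Q \<longrightarrow> ennreal (w (x, t)) = h (x, t))"
    have "(\<integral>\<^sup>+x\<in>cbox 0 1. A * ennreal (w (x, t)) \<partial>lborel) = (\<integral>\<^sup>+x\<in>?Q. A * h (x, t) \<partial>lborel)"
      if "t \<in> {0..1}"
    proof (rule nn_integral_cong_AE)
      from t that have "AE x in lborel. x \<in> ?Q \<longrightarrow> ennreal (w (x, t)) = h (x, t)"
        by simp
      with AE_cbox_iff_half_open_cube
      show "AE x in lborel. A * ennreal (w (x, t)) * indicator (cbox 0 1) x = A * h (x, t) * indicator ?Q x"
        by eventually_elim (auto split: split_indicator)
    qed
    then show "(\<integral>\<^sup>+x\<in>cbox 0 1. A * ennreal (w (x, t)) \<partial>lborel) * indicator {0..1} t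
      = (\<integral>\<^sup>+x\<in>?Q. A * h (x, t) \<partial>lborel) * indicator {0..1} t"
      by (auto split: split_indicator)
  qed
  also have "\<dots> = A * (\<integral>\<^sup>+t\<in>{0..1}. (\<integral>\<^sup>+x\<in>?Q. h (x, t) \<partial>lborel) \<partial>lborel)"
    by (simp add: nn_integral_cmult mult.assoc)
  also have "(\<integral>\<^sup>+t\<in>{0..1}. (\<integral>\<^sup>+x\<in>?Q. h (x, t) \<partial>lborel) \<partial>lborel)
      = (\<integral>\<^sup>+x\<in>?Q. (\<integral>\<^sup>+t\<in>{0..1}. h (x - (2 * t) *\<^sub>R zvec k, t) \<partial>lborel) \<partial>lborel)"
    using nn_integral_lines_periodic[OF h hper, of k] by simp
  also have "\<dots> = (\<integral>\<^sup>+x\<in>?Q. rho_star w x k \<partial>lborel)"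
    unfolding rho_star_def nn_integral_completion
  proof (rule nn_integral_cong_AE, rule AE_mp[OF lines[of k]], intro AE_I2 impI)
    fix x
    assume x: "x \<in> ?Q \<longrightarrow> (AE t in lborel. t \<in> {0..1} \<longrightarrow>
      ennreal (w (x - (2 * t) *\<^sub>R zvec k, t)) = h (x - (2 * t) *\<^sub>R zvec k, t))"
    have "(\<integral>\<^sup>+t\<in>{0..1}. h (x - (2 * t) *\<^sub>R zvec k, t) \<partial>lborel)
        = (\<integral>\<^sup>+t\<in>{0..1}. ennreal (w (x - (2 * t) *\<^sub>R zvec k, t)) \<partial>lborel)" if "x \<in> ?Q"
    proof (rule nn_integral_cong_AE)
      from x that have "AE t in lborel. t \<in> {0..1} \<longrightarrow>
          ennreal (w (x - (2 * t) *\<^sub>R zvec k, t)) = h (x - (2 * t) *\<^sub>R zvec k, t)"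
        by simp
      then show "AE t in lborel. h (x - (2 * t) *\<^sub>R zvec k, t) * indicator {0..1} t
          = ennreal (w (x - (2 * t) *\<^sub>R zvec k, t)) * indicator {0..1} t"
        by eventually_elim (auto split: split_indicator)
    qed
    then show "(\<integral>\<^sup>+t\<in>{0..1}. h (x - (2 * t) *\<^sub>R zvec k, t) \<partial>lborel) * indicator ?Q x
        = (\<integral>\<^sup>+t\<in>{0..1}. ennreal (w (x - (2 * t) *\<^sub>R zvec k, t)) \<partial>lborel) * indicator ?Q x"
      by (auto split: split_indicator)
  qed
  also have "\<dots> \<le> (\<integral>\<^sup>+x\<in>?Q. (SUP x. rho_star w x k) \<partial>lborel)"
    by (intro nn_integral_mono mult_right_mono SUP_upper) auto
  also have "\<dots> = (SUP x. rho_star w x k)"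
    by (simp add: nn_integral_cmult_indicator emeasure_half_open_cube)
  finally show ?thesis
    by (simp add: mult_left_mono)
qed

lemma cmod_schroedinger_le:
  fixes u0 :: "real ^ 'd::finite \<Rightarrow> complex"
  shows "(cmod (schroedinger u0 x t))\<^sup>2 \<le> real (card (spectrum u0)) * (\<Sum>k\<in>spectrum u0. (cmod (fourier u0 k))\<^sup>2)"
proof -
  have "cmod (schroedinger u0 x t) \<le> (\<Sum>k\<in>spectrum u0. cmod (fourier u0 k))"
    unfolding schroedinger_def by (rule sum_norm_le) (simp add: norm_mult)
  then have "(cmod (schroedinger u0 x t))\<^sup>2 \<le> (\<Sum>k\<in>spectrum u0. cmod (fourier u0 k))\<^sup>2"
    by (rule power_mono) simp
  also have "\<dots> \<le> (\<Sum>k\<in>spectrum u0. (cmod (fourier u0 k))\<^sup>2) * real (card (spectrum u0))"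
    by (rule sum_squared_le_sum_of_squares)
  finally show ?thesis
    by (simp add: mult.commute)
qed

text \<open>
  Cauchy-Schwarz bounds \<open>|u|\<^sup>2\<close> by a constant, and the mass of \<open>w\<close> is
  at most the supremum of the line integrals for every frequency, in particular for the one
  where this supremum is least.
\<close>
lemma stein_ineq_card:
  fixes u0 :: "real ^ 'd::finite \<Rightarrow> complex"
  assumes w: "w \<in> weights" and "u0 \<in> trig_polys"
  shows "stein_ineq (of_nat (card (spectrum u0))) w u0"
proof -
  have fin: "finite (spectrum u0)"
    by (rule finite_spectrum[OF \<open>u0 \<in> trig_polys\<close>])
  let ?n = "of_nat (card (spectrum u0)) :: ennreal"
  define I where "I A = (\<integral>\<^sup>+t\<in>{0..1}. (\<integral>\<^sup>+x\<in>cbox 0 1. A * ennreal (w (x, t)) \<partial>lebesgue) \<partial>lebesgue)" for A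
  have w0: "0 \<le> w z" for z
    using w by (cases z) (simp add: weights_def)
  let ?E = "\<Sum>k\<in>spectrum u0. ennreal ((cmod (fourier u0 k))\<^sup>2)"
  have "ennreal ((cmod (schroedinger u0 x t))\<^sup>2 * w (x, t)) \<le> (?n * ?E) * ennreal (w (x, t))" for x t
  proof -
    have "ennreal ((cmod (schroedinger u0 x t))\<^sup>2) \<le> ?n * ?E"
      using cmod_schroedinger_le[of u0 x t]
      by (simp add: ennreal_of_nat_eq_real_of_nat sum_nonneg flip: ennreal_mult)
    then show ?thesis
      by (simp add: ennreal_mult w0 mult_right_mono)
  qed
  then have "weighted_energy w u0 \<le> I (?n * ?E)"
    unfolding weighted_energy_def I_def
    by (intro nn_integral_mono mult_right_mono) auto
  also have "\<dots> \<le> ?n * (\<Sum>k\<in>spectrum u0. ennreal ((cmod (fourier u0 k))\<^sup>2) * (SUP x. rho_star w x k))"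
  proof (cases "spectrum u0 = {}")
    case False
    define R where "R k = (SUP x. rho_star w x k)" for k
    obtain k0 where k0: "k0 \<in> spectrum u0" and min: "\<And>k. k \<in> spectrum u0 \<Longrightarrow> R k0 \<le> R k"
      using Min_in[of "R ` spectrum u0"] Min_le[of "R ` spectrum u0"] fin False by fastforce
    have "I (?n * ?E) \<le> ?n * ?E * R k0"
      unfolding I_def R_def by (rule nn_integral_weight_le_SUP_rho_star[OF w])
    also have "\<dots> = ?n * (\<Sum>k\<in>spectrum u0. ennreal ((cmod (fourier u0 k))\<^sup>2) * R k0)"
      by (simp only: sum_distrib_right mult.assoc)
    also have "\<dots> \<le> ?n * (\<Sum>k\<in>spectrum u0. ennreal ((cmod (fourier u0 k))\<^sup>2) * R k)"
      by (intro mult_left_mono sum_mono min) auto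
    finally show ?thesis
      by (simp add: R_def)
  qed (simp add: I_def)
  finally show ?thesis
    by (simp add: stein_ineq_def)
qed

lemma stein_const_card_le: "stein_const_card TYPE('d::finite) n \<le> of_nat n"
  unfolding stein_const_card_def
  by (rule Inf_lower) (auto intro: stein_ineq_card)

section \<open>Riesz products in space-time\<close>

text \<open>
  A nonnegative function whose Fourier coefficients can be read off: the coefficient of a frequency
  is the sum of \<open>2\<^sup>-\<^sup>r\<close> over its representations as a signed sum of \<open>r\<close> of the given frequencies.
\<close>
definition riesz_product ::
    "'b set \<Rightarrow> ('b \<Rightarrow> int ^ 'd::finite) \<Rightarrow> ('b \<Rightarrow> int) \<Rightarrow> (real ^ 'd) \<times> real \<Rightarrow> real" where
  "riesz_product B \<beta> \<tau> = (\<lambda>(x, t). \<Prod>b\<in>B. 1 + cos (2 * pi * (x \<bullet> zvec (\<beta> b) + t * of_int (\<tau> b))))"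

definition signs :: "'b set \<Rightarrow> ('b \<Rightarrow> int) set" where
  "signs B = (\<Pi>\<^sub>E b\<in>B. {-1, 0, 1})"

text \<open>
  The Euclidean inner product restricted to the integer lattice, with integer values, so that
  vanishing of a frequency can be decided by divisibility.
\<close>
definition idot :: "int ^ 'd::finite \<Rightarrow> int ^ 'd \<Rightarrow> int" where
  "idot k l = (\<Sum>i\<in>UNIV. k $ i * l $ i)"

lemma zvec_inner_zvec: "zvec k \<bullet> zvec l = of_int (idot k l)"
  by (simp add: zvec_def idot_def inner_vec_def)

lemma norm_zvec_sq: "(norm (zvec k))\<^sup>2 = of_int (idot k k)"
  by (simp add: power2_norm_eq_inner zvec_inner_zvec)

lemma finite_signs: "finite B \<Longrightarrow> finite (signs B)"
  by (simp add: signs_def finite_PiE)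

lemma riesz_product_expansion:
  assumes "finite B"
  shows "complex_of_real (\<Prod>b\<in>B. 1 + cos (\<theta> b)) =
    (\<Sum>g\<in>signs B. (1 / 2) ^ card {b\<in>B. g b \<noteq> 0} * cis (\<Sum>b\<in>B. of_int (g b) * \<theta> b))"
proof -
  define c :: "int \<Rightarrow> complex" where "c s = (if s = 0 then 1 else 1 / 2)" for s
  have factor: "complex_of_real (1 + cos (\<theta> b)) = (\<Sum>s\<in>{-1, 0, 1}. c s * cis (of_int s * \<theta> b))" for b
    by (simp add: c_def complex_eq_iff)
  have coeff: "(\<Prod>b\<in>B. c (g b)) = (1 / 2) ^ card {b\<in>B. g b \<noteq> 0}" for g
    using assms by (simp add: c_def prod.If_cases Int_def conj_commute)
  have "complex_of_real (\<Prod>b\<in>B. 1 + cos (\<theta> b)) = (\<Prod>b\<in>B. \<Sum>s\<in>{-1, 0, 1}. c s * cis (of_int s * \<theta> b))"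
    unfolding of_real_prod factor ..
  also have "\<dots> = (\<Sum>g\<in>signs B. \<Prod>b\<in>B. c (g b) * cis (of_int (g b) * \<theta> b))"
    unfolding signs_def by (rule prod_sum_PiE) (use assms in auto)
  also have "\<dots> = (\<Sum>g\<in>signs B. (1 / 2) ^ card {b\<in>B. g b \<noteq> 0} * cis (\<Sum>b\<in>B. of_int (g b) * \<theta> b))"
    by (simp add: prod.distrib coeff cis_sum)
  finally show ?thesis .
qed

lemma riesz_product_expansion_spacetime:
  fixes \<beta> :: "'b \<Rightarrow> int ^ 'd::finite"
  assumes "finite B"
  shows "complex_of_real (riesz_product B \<beta> \<tau> (x, t)) =
    (\<Sum>g\<in>signs B. (1 / 2) ^ card {b\<in>B. g b \<noteq> 0} *
      cis (2 * pi * (x \<bullet> zvec (\<Sum>b\<in>B. g b *s \<beta> b) + t * of_int (\<Sum>b\<in>B. g b * \<tau> b))))"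
  unfolding riesz_product_def prod.case riesz_product_expansion[OF assms]
proof (intro sum.cong refl arg_cong2[where f = "(*)"] arg_cong[where f = cis])
  fix g :: "'b \<Rightarrow> int"
  show "(\<Sum>b\<in>B. of_int (g b) * (2 * pi * (x \<bullet> zvec (\<beta> b) + t * of_int (\<tau> b))))
    = 2 * pi * (x \<bullet> zvec (\<Sum>b\<in>B. g b *s \<beta> b) + t * of_int (\<Sum>b\<in>B. g b * \<tau> b))"
    by (simp add: zvec_sum zvec_scale inner_sum_right sum_distrib_left distrib_left sum.distrib
        algebra_simps)
qed

lemma riesz_product_nonneg: "0 \<le> riesz_product B \<beta> \<tau> p"
proof -
  have "0 \<le> 1 + cos y" for y :: real
    using cos_ge_minus_one[of y] by linarith
  then show ?thesis
    by (auto simp: riesz_product_def case_prod_beta intro!: prod_nonneg)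
qed

lemma continuous_on_riesz_product: "continuous_on S (riesz_product B \<beta> \<tau>)"
  unfolding riesz_product_def case_prod_beta by (intro continuous_intros)

lemma riesz_product_in_weights: "riesz_product B \<beta> \<tau> \<in> weights"
proof -
  have periodic: "riesz_product B \<beta> \<tau> (x + zvec k, t + of_int m) = riesz_product B \<beta> \<tau> (x, t)" for x t k m
  proof -
    have "cos (2 * pi * ((x + zvec k) \<bullet> zvec (\<beta> b) + (t + of_int m) * of_int (\<tau> b)))
      = cos (2 * pi * (x \<bullet> zvec (\<beta> b) + t * of_int (\<tau> b)))" for b
    proof -
      define n where "n = idot k (\<beta> b) + m * \<tau> b"
      have "2 * pi * ((x + zvec k) \<bullet> zvec (\<beta> b) + (t + of_int m) * of_int (\<tau> b))
        = 2 * pi * (x \<bullet> zvec (\<beta> b) + t * of_int (\<tau> b)) + 2 * pi * of_int n"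
        by (simp add: n_def inner_add_left zvec_inner_zvec algebra_simps)
      then show ?thesis
        by (simp add: cos_add)
    qed
    then show ?thesis
      by (simp add: riesz_product_def)
  qed
  have "compact (cbox (0::real^'a) 1 \<times> {0..1::real})"
    by (intro compact_Times) auto
  then have "set_integrable lborel (cbox 0 1 \<times> {0..1}) (riesz_product B \<beta> \<tau>)"
    unfolding set_integrable_def by (intro borel_integrable_compact continuous_on_riesz_product)
  then have "set_integrable lebesgue (cbox 0 1 \<times> {0..1}) (riesz_product B \<beta> \<tau>)"
    unfolding set_integrable_def by (subst integrable_completion) (auto dest: borel_measurable_integrable)
  moreover have "(\<lambda>t. riesz_product B \<beta> \<tau> (x - (2 * t) *\<^sub>R zvec k, t)) \<in> borel_measurable lebesgue" for x k
  proof (rule measurable_completion)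
    have "continuous_on UNIV (\<lambda>t. riesz_product B \<beta> \<tau> (x - (2 * t) *\<^sub>R zvec k, t))"
      unfolding riesz_product_def prod.case by (intro continuous_intros)
    then show "(\<lambda>t. riesz_product B \<beta> \<tau> (x - (2 * t) *\<^sub>R zvec k, t)) \<in> borel_measurable lborel"
      by (simp add: borel_measurable_continuous_onI)
  qed
  ultimately show ?thesis
    using periodic riesz_product_nonneg by (auto simp: weights_def)
qed

text \<open>
  Along the line \<open>x - 2tm\<close> the factor of index \<open>b\<close> oscillates in \<open>t\<close> with frequency
  \<open>\<tau>\<^sub>b - 2 m \<cdot> \<beta>\<^sub>b\<close>. If no nontrivial signed sum of these frequencies vanishes, then
  only the constant term of the expansion survives integration, whatever the phase \<open>x\<close> is.
\<close>
lemma rho_star_riesz_product: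
  fixes \<beta> :: "'b \<Rightarrow> int ^ 'd::finite"
  assumes "finite B"
    and dissociated: "\<And>g. g \<in> signs B \<Longrightarrow> (\<Sum>b\<in>B. g b * (\<tau> b - 2 * idot m (\<beta> b))) = 0 \<Longrightarrow> (\<forall>b\<in>B. g b = 0)"
  shows "rho_star (riesz_product B \<beta> \<tau>) x m = 1"
proof -
  define T where "T g = (\<Sum>b\<in>B. g b * (\<tau> b - 2 * idot m (\<beta> b)))" for g
  define C :: "('b \<Rightarrow> int) \<Rightarrow> complex" where
    "C g = (1 / 2) ^ card {b\<in>B. g b \<noteq> 0} * cis (2 * pi * (x \<bullet> zvec (\<Sum>b\<in>B. g b *s \<beta> b)))" for g
  \<comment> \<open>The sign pattern of the constant term of the expansion.\<close>
  define g0 where "g0 = (\<lambda>b\<in>B. 0 :: int)"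
  have "complex_of_real (riesz_product B \<beta> \<tau> (x - (2 * t) *\<^sub>R zvec m, t)) =
      (\<Sum>g\<in>signs B. C g * cis (2 * pi * (t * of_int (T g))))" for t
    unfolding riesz_product_expansion_spacetime[OF assms(1)] C_def
  proof (intro sum.cong refl)
    fix g
    have "x \<bullet> zvec (\<Sum>b\<in>B. g b *s \<beta> b) + t * of_int (T g) =
      (x - (2 * t) *\<^sub>R zvec m) \<bullet> zvec (\<Sum>b\<in>B. g b *s \<beta> b) + t * of_int (\<Sum>b\<in>B. g b * \<tau> b)"
      by (simp add: T_def zvec_sum zvec_scale inner_sum_right inner_diff_left zvec_inner_zvec
          sum_subtractf sum_distrib_left algebra_simps)
    from this[symmetric]
    show "(1 / 2) ^ card {b\<in>B. g b \<noteq> 0} * cis (2 * pi * ((x - (2 * t) *\<^sub>R zvec m) \<bullet> zvec (\<Sum>b\<in>B. g b *s \<beta> b) + t * of_int (\<Sum>b\<in>B. g b * \<tau> b)))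
      = (1 / 2) ^ card {b\<in>B. g b \<noteq> 0} * cis (2 * pi * (x \<bullet> zvec (\<Sum>b\<in>B. g b *s \<beta> b))) * cis (2 * pi * (t * of_int (T g)))"
      by (simp only: mult.assoc cis_mult distrib_left)
  qed
  then have "rho_star (riesz_product B \<beta> \<tau>) x m = ennreal (Re (\<Sum>g\<in>signs B. C g * of_bool (T g = 0)))"
    unfolding rho_star_def
    by (intro nn_integral_trig_sum_interval finite_signs assms(1) riesz_product_nonneg)
  also have "(\<Sum>g\<in>signs B. C g * of_bool (T g = 0)) = (\<Sum>g\<in>signs B. if g = g0 then C g else 0)"
  proof (intro sum.cong refl)
    fix g assume g: "g \<in> signs B"
    have "T g = 0 \<longleftrightarrow> g = g0"
    proof
      assume "T g = 0"
      with dissociated[OF g] have "\<forall>b\<in>B. g b = 0"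
        by (simp add: T_def)
      with g show "g = g0"
        by (auto simp: g0_def signs_def fun_eq_iff PiE_def extensional_def)
    qed (simp add: T_def g0_def)
    then show "C g * of_bool (T g = 0) = (if g = g0 then C g else 0)"
      by simp
  qed
  also have "\<dots> = C g0"
    using finite_signs[OF assms(1)] by (simp add: signs_def g0_def)
  also have "\<dots> = 1"
    by (simp add: C_def g0_def cong: conj_cong)
  finally show ?thesis by simp
qed

definition dirichlet_sum :: "(int ^ 'd::finite) set \<Rightarrow> real ^ 'd \<Rightarrow> complex" where
  "dirichlet_sum K = (\<lambda>x. \<Sum>k\<in>K. cis (2 * pi * (x \<bullet> zvec k)))"

lemma
  assumes "finite K"
  shows dirichlet_sum_trig_poly: "dirichlet_sum K \<in> trig_polys"
    and fourier_dirichlet_sum: "fourier (dirichlet_sum K) k = of_bool (k \<in> K)"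
    and spectrum_dirichlet_sum: "spectrum (dirichlet_sum K) = K"
    and L2_norm_sq_dirichlet_sum: "L2_norm_sq (dirichlet_sum K) = of_nat (card K)"
proof -
  show tp: "dirichlet_sum K \<in> trig_polys"
    unfolding trig_polys_def dirichlet_sum_def using assms by (auto intro!: exI[of _ K] exI[of _ "\<lambda>_. 1"])
  show f: "fourier (dirichlet_sum K) k = of_bool (k \<in> K)" for k
    using fourier_trig_sum[OF assms, of "\<lambda>_. 1" k] by (simp add: dirichlet_sum_def)
  show s: "spectrum (dirichlet_sum K) = K"
    by (simp add: spectrum_def f)
  show "L2_norm_sq (dirichlet_sum K) = of_nat (card K)"
    by (simp add: parseval_trig_poly[OF tp] s f cong: sum.cong)
qed

text \<open>
  The frequencies of \<open>|u|\<^sup>2\<close> are \<open>(k - l, |k|\<^sup>2 - |l|\<^sup>2)\<close>. All coefficients of \<open>|u|\<^sup>2\<close> and of the Riesz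
  product are nonnegative, so there is no cancellation, and each pair \<open>(k, l)\<close> contributes at least
  the coefficient \<open>2\<^sup>-\<^sup>r\<close> belonging to one representation of the opposite frequency by at most
  \<open>r\<close> factors.
\<close>
lemma weighted_energy_riesz_product_ge:
  fixes \<beta> :: "'b \<Rightarrow> int ^ 'd::finite"
  assumes "finite B" "finite K"
    and diff: "\<And>k l. k \<in> K \<Longrightarrow> l \<in> K \<Longrightarrow> \<exists>g\<in>signs B. card {b\<in>B. g b \<noteq> 0} \<le> r \<and>
        (\<Sum>b\<in>B. g b *s \<beta> b) = l - k \<and> (\<Sum>b\<in>B. g b * \<tau> b) = idot l l - idot k k"
  shows "ennreal ((real (card K))\<^sup>2 / 2 ^ r) \<le> weighted_energy (riesz_product B \<beta> \<tau>) (dirichlet_sum K)"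
proof -
  let ?u = "schroedinger (dirichlet_sum K)"
  \<comment> \<open>Terms of the integrand: a pair of frequencies from \<open>|u|\<^sup>2\<close> and a sign pattern from the weight.\<close>
  define S where "S = K \<times> K \<times> signs B"
  define c :: "('b \<Rightarrow> int) \<Rightarrow> real" where "c g = (1 / 2) ^ card {b\<in>B. g b \<noteq> 0}" for g
  define X :: "(int ^ 'd) \<times> (int ^ 'd) \<times> ('b \<Rightarrow> int) \<Rightarrow> int ^ 'd" where
    "X = (\<lambda>(k, l, g). k - l + (\<Sum>b\<in>B. g b *s \<beta> b))"
  define T :: "(int ^ 'd) \<times> (int ^ 'd) \<times> ('b \<Rightarrow> int) \<Rightarrow> int" where
    "T = (\<lambda>(k, l, g). idot k k - idot l l + (\<Sum>b\<in>B. g b * \<tau> b))"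
  have finS: "finite S"
    by (simp add: S_def assms finite_signs)
  have u: "?u x t = (\<Sum>k\<in>K. cis (2 * pi * (x \<bullet> zvec k + t * of_int (idot k k))))" for x t
    by (simp add: schroedinger_def spectrum_dirichlet_sum fourier_dirichlet_sum assms norm_zvec_sq cong: sum.cong)
  have expand: "complex_of_real ((cmod (?u x t))\<^sup>2 * riesz_product B \<beta> \<tau> (x, t)) =
      (\<Sum>s\<in>S. complex_of_real (c (snd (snd s))) * cis (2 * pi * (x \<bullet> zvec (X s) + t * of_int (T s))))" for x t
  proof -
    have "complex_of_real ((cmod (?u x t))\<^sup>2 * riesz_product B \<beta> \<tau> (x, t)) =
      (\<Sum>k\<in>K. \<Sum>l\<in>K. cis (2 * pi * (x \<bullet> zvec k + t * of_int (idot k k))) * cnj (cis (2 * pi * (x \<bullet> zvec l + t * of_int (idot l l))))) *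
      (\<Sum>g\<in>signs B. complex_of_real (c g) * cis (2 * pi * (x \<bullet> zvec (\<Sum>b\<in>B. g b *s \<beta> b) + t * of_int (\<Sum>b\<in>B. g b * \<tau> b))))"
      unfolding of_real_mult complex_norm_square u riesz_product_expansion_spacetime[OF assms(1)] c_def
      by (simp add: sum_product)
    also have "\<dots> = (\<Sum>k\<in>K. \<Sum>l\<in>K. \<Sum>g\<in>signs B. complex_of_real (c g) * cis (2 * pi * (x \<bullet> zvec (X (k, l, g)) + t * of_int (T (k, l, g)))))"
      unfolding sum_distrib_right
    proof (intro sum.cong refl, unfold sum_distrib_left, intro sum.cong refl)
      fix k l :: "int ^ 'd" and g :: "'b \<Rightarrow> int"
      define y where "y = (\<Sum>b\<in>B. g b *s \<beta> b)"
      define s where "s = (\<Sum>b\<in>B. g b * \<tau> b)"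
      have commute: "a * b * (c * d) = c * (a * b * d)" for a b c d :: complex
        by simp
      have phase: "cis (2 * pi * (x \<bullet> zvec k + t * of_int (idot k k))) * cnj (cis (2 * pi * (x \<bullet> zvec l + t * of_int (idot l l)))) *
        cis (2 * pi * (x \<bullet> zvec y + t * of_int s))
        = cis (2 * pi * (x \<bullet> zvec (k - l + y) + t * of_int (idot k k - idot l l + s)))"
        unfolding cis_cnj cis_mult by (simp add: zvec_diff zvec_add algebra_simps)
      show "cis (2 * pi * (x \<bullet> zvec k + t * of_int (idot k k))) * cnj (cis (2 * pi * (x \<bullet> zvec l + t * of_int (idot l l)))) *
        (complex_of_real (c g) * cis (2 * pi * (x \<bullet> zvec (\<Sum>b\<in>B. g b *s \<beta> b) + t * of_int (\<Sum>b\<in>B. g b * \<tau> b))))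
        = complex_of_real (c g) * cis (2 * pi * (x \<bullet> zvec (X (k, l, g)) + t * of_int (T (k, l, g))))"
        unfolding X_def T_def prod.case y_def[symmetric] s_def[symmetric] commute phase ..
    qed
    also have "\<dots> = (\<Sum>s\<in>S. complex_of_real (c (snd (snd s))) * cis (2 * pi * (x \<bullet> zvec (X s) + t * of_int (T s))))"
      by (simp add: S_def sum.cartesian_product case_prod_beta)
    finally show ?thesis .
  qed
  have "weighted_energy (riesz_product B \<beta> \<tau>) (dirichlet_sum K)
      = ennreal (Re (\<Sum>s\<in>S. complex_of_real (c (snd (snd s))) * of_bool (X s = 0 \<and> T s = 0)))"
    unfolding weighted_energy_def
    by (rule nn_integral_trig_sum_spacetime[OF finS _ expand]) (simp add: riesz_product_nonneg)
  also have "Re (\<Sum>s\<in>S. complex_of_real (c (snd (snd s))) * of_bool (X s = 0 \<and> T s = 0)) =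
      (\<Sum>s\<in>S. c (snd (snd s)) * of_bool (X s = 0 \<and> T s = 0))"
    unfolding Re_sum by (intro sum.cong refl) (simp add: of_bool_def)
  finally have energy: "weighted_energy (riesz_product B \<beta> \<tau>) (dirichlet_sum K)
      = ennreal (\<Sum>s\<in>S. c (snd (snd s)) * of_bool (X s = 0 \<and> T s = 0))" .
  have "(real (card K))\<^sup>2 / 2 ^ r = (\<Sum>k\<in>K. \<Sum>l\<in>K. (1 / 2) ^ r)"
    by (simp add: power2_eq_square power_divide)
  also have "\<dots> \<le> (\<Sum>k\<in>K. \<Sum>l\<in>K. \<Sum>g\<in>signs B. c g * of_bool (X (k, l, g) = 0 \<and> T (k, l, g) = 0))"
  proof (intro sum_mono)
    fix k l assume "k \<in> K" "l \<in> K"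
    then obtain g where g: "g \<in> signs B" and r: "card {b\<in>B. g b \<noteq> 0} \<le> r"
      and zero: "X (k, l, g) = 0" "T (k, l, g) = 0"
      using diff[of k l] by (auto simp: X_def T_def)
    have "(1 / 2 :: real) ^ r \<le> c g"
      unfolding c_def by (rule power_decreasing[OF r]) auto
    also have "\<dots> = c g * of_bool (X (k, l, g) = 0 \<and> T (k, l, g) = 0)"
      by (simp add: zero)
    also have "\<dots> \<le> (\<Sum>g\<in>signs B. c g * of_bool (X (k, l, g) = 0 \<and> T (k, l, g) = 0))"
      by (rule member_le_sum[OF g]) (auto simp: c_def finite_signs assms)
    finally show "(1 / 2) ^ r \<le> (\<Sum>g\<in>signs B. c g * of_bool (X (k, l, g) = 0 \<and> T (k, l, g) = 0))" .
  qed
  also have "\<dots> = (\<Sum>s\<in>S. c (snd (snd s)) * of_bool (X s = 0 \<and> T s = 0))"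
    by (simp add: S_def sum.cartesian_product case_prod_beta)
  finally show ?thesis
    unfolding energy by (rule ennreal_leI)
qed

text \<open>
  The energy is at least \<open>|K|\<^sup>2 / 2\<^sup>r\<close>, while the line integrals are \<open>1\<close> and the squared
  \<open>L\<^sup>2\<close> norm is \<open>|K|\<close>.
\<close>
lemma mt_constant_riesz_product_ge:
  fixes \<beta> :: "'b \<Rightarrow> int ^ 'd::finite"
  assumes "finite B" "finite K" "K \<noteq> {}"
    and dissociated: "\<And>m g. m \<in> K \<Longrightarrow> g \<in> signs B \<Longrightarrow>
        (\<Sum>b\<in>B. g b * (\<tau> b - 2 * idot m (\<beta> b))) = 0 \<Longrightarrow> (\<forall>b\<in>B. g b = 0)"
    and diff: "\<And>k l. k \<in> K \<Longrightarrow> l \<in> K \<Longrightarrow> \<exists>g\<in>signs B. card {b\<in>B. g b \<noteq> 0} \<le> r \<and>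
        (\<Sum>b\<in>B. g b *s \<beta> b) = l - k \<and> (\<Sum>b\<in>B. g b * \<tau> b) = idot l l - idot k k"
    and mt: "mt_ineq C (riesz_product B \<beta> \<tau>) (dirichlet_sum K)"
  shows "ennreal (real (card K) / 2 ^ r) \<le> C"
proof -
  let ?n = "real (card K)"
  have n: "0 < ?n"
    using assms by (simp add: card_gt_0_iff)
  have "(SUP (x, k)\<in>UNIV \<times> K. rho_star (riesz_product B \<beta> \<tau>) x k) = (SUP p\<in>(UNIV :: (real^'d) set) \<times> K. 1)"
    using dissociated by (intro SUP_cong) (auto intro!: rho_star_riesz_product assms(1))
  also have "\<dots> = 1"
    using \<open>K \<noteq> {}\<close> by simp
  finally have "weighted_energy (riesz_product B \<beta> \<tau>) (dirichlet_sum K) \<le> C * ennreal ?n"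
    using mt by (simp add: mt_ineq_def spectrum_dirichlet_sum L2_norm_sq_dirichlet_sum assms
        ennreal_of_nat_eq_real_of_nat)
  with weighted_energy_riesz_product_ge[OF assms(1,2) diff]
  have "ennreal (?n\<^sup>2 / 2 ^ r) \<le> C * ennreal ?n"
    by (rule order.trans)
  then show ?thesis
  proof (cases C)
    case (real c)
    with \<open>ennreal (?n\<^sup>2 / 2 ^ r) \<le> C * ennreal ?n\<close> have "?n\<^sup>2 / 2 ^ r \<le> c * ?n"
      by (simp flip: ennreal_mult)
    then show ?thesis
      using n real by (simp add: power2_eq_square field_simps)
  qed simp
qed

section \<open>Lacunary frequencies\<close>

text \<open>
  The term of least \<open>3\<close>-adic valuation cannot be cancelled by the others, all of which are
  divisible by a higher power of \<open>3\<close>.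
\<close>
lemma signed_sum_distinct_valuations:
  fixes v :: "'b \<Rightarrow> nat" and u g :: "'b \<Rightarrow> int"
  assumes "finite B" and inj: "inj_on v B" and u: "\<And>b. b \<in> B \<Longrightarrow> \<not> 3 dvd u b"
    and g: "g \<in> signs B" and sum0: "(\<Sum>b\<in>B. g b * (3 ^ v b * u b)) = 0"
  shows "\<forall>b\<in>B. g b = 0"
proof (rule ccontr)
  assume "\<not> (\<forall>b\<in>B. g b = 0)"
  then have "\<exists>b. b \<in> B \<and> g b \<noteq> 0" by blast
  from ex_has_least_nat[of "\<lambda>b. b \<in> B \<and> g b \<noteq> 0" _ v] this
  obtain b0 where b0: "b0 \<in> B" "g b0 \<noteq> 0" and least: "\<And>b. b \<in> B \<Longrightarrow> g b \<noteq> 0 \<Longrightarrow> v b0 \<le> v b"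
    by blast
  have "3 ^ Suc (v b0) dvd (\<Sum>b\<in>B - {b0}. g b * (3 ^ v b * u b))"
  proof (rule dvd_sum)
    fix b assume b: "b \<in> B - {b0}"
    show "3 ^ Suc (v b0) dvd g b * (3 ^ v b * u b)"
    proof (cases "g b = 0")
      case False
      then have "v b0 \<le> v b" "v b \<noteq> v b0"
        using least b inj b0 by (auto dest: inj_onD)
      then have "(3::int) ^ Suc (v b0) dvd 3 ^ v b"
        by (intro le_imp_power_dvd) auto
      then show ?thesis
        by (simp only: dvd_mult dvd_mult2)
    qed simp
  qed
  moreover have "g b0 * (3 ^ v b0 * u b0) = - (\<Sum>b\<in>B - {b0}. g b * (3 ^ v b * u b))"
    using sum0 b0 by (simp add: sum.remove[OF \<open>finite B\<close>])
  ultimately have "3 ^ Suc (v b0) dvd g b0 * (3 ^ v b0 * u b0)"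
    by simp
  then have "3 ^ v b0 * 3 dvd 3 ^ v b0 * (g b0 * u b0)"
    by (simp add: mult_ac)
  then have "3 dvd g b0 * u b0"
    by (simp only: dvd_mult_cancel_left) simp
  moreover have "g b0 = 1 \<or> g b0 = -1"
    using g b0 by (auto simp: signs_def PiE_def Pi_def)
  ultimately show False
    using u[OF b0(1)] by auto
qed

definition ternary_freq :: "('d::finite \<Rightarrow> nat) \<Rightarrow> int ^ 'd" where
  "ternary_freq p = (\<chi> i. 3 ^ p i)"

definition ternary_freqs :: "('d::finite \<Rightarrow> nat set) \<Rightarrow> (int ^ 'd) set" where
  "ternary_freqs J = ternary_freq ` (\<Pi>\<^sub>E i\<in>UNIV. J i)"

lemma finite_ternary_freqs: "(\<And>i. finite (J i)) \<Longrightarrow> finite (ternary_freqs J)"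
  by (simp add: ternary_freqs_def finite_PiE)

lemma card_ternary_freqs: "card (ternary_freqs J) = (\<Prod>i\<in>UNIV. card (J i))"
proof -
  have "inj ternary_freq"
    by (rule injI) (simp add: ternary_freq_def vec_eq_iff fun_eq_iff)
  then show ?thesis
    unfolding ternary_freqs_def by (subst card_image) (auto simp: card_PiE intro: inj_on_subset)
qed

text \<open>
  The frequencies \<open>(a e\<^sub>i, a\<^sup>2)\<close> with \<open>a = 3\<^sup>j\<close> lie on the paraboloid that carries the space-time
  frequencies of solutions. There is one factor per pair of a coordinate \<open>i\<close> and an exponent
  \<open>j \<in> J i\<close>, not one per frequency in \<^term>\<open>ternary_freqs J\<close>: the number of factors is the sum of the
  sizes of the sets \<open>J i\<close>, the number of frequencies is their product.
\<close>
definition ternary_weight :: "('d::finite \<Rightarrow> nat set) \<Rightarrow> (real ^ 'd) \<times> real \<Rightarrow> real" where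
  "ternary_weight J = riesz_product (SIGMA i:UNIV. J i) (\<lambda>(i, j). axis i (3 ^ j)) (\<lambda>(i, j). 9 ^ j)"

definition separated :: "('d \<Rightarrow> nat set) \<Rightarrow> bool" where
  "separated J \<longleftrightarrow> (\<forall>i i'. i \<noteq> i' \<longrightarrow>
    (\<forall>j\<in>J i. \<forall>j'\<in>J i'. j < j') \<or> (\<forall>j\<in>J i. \<forall>j'\<in>J i'. j' < j))"

lemma idot_axis: "idot m (axis i c) = m $ i * c"
proof -
  have "idot m (axis i c) = (\<Sum>i'\<in>UNIV. if i' = i then m $ i * c else 0)"
    unfolding idot_def by (intro sum.cong) (auto simp: axis_def)
  then show ?thesis by simp
qed

text \<open>
  For \<open>m = (3\<^bsup>p i\<^esup>)\<^sub>i\<close> the frequency of the factor \<open>(i, j)\<close> along the line is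
  \<open>3\<^sup>j (3\<^sup>j - 2 \<cdot> 3\<^bsup>p i\<^esup>)\<close>, of \<open>3\<close>-adic valuation \<open>j + min j (p i)\<close>: the remaining factor is
  congruent to \<open>1\<close>, \<open>-1\<close> or \<open>-2\<close> modulo \<open>3\<close>, as \<open>j\<close> is less than,
  equal to or greater than \<open>p i\<close>. For fixed \<open>i\<close> the valuation increases strictly with \<open>j\<close>, and separated blocks of exponents lead to disjoint ranges of valuations.
\<close>
lemma ternary_dissociated:
  fixes J :: "'d::finite \<Rightarrow> nat set"
  assumes fin: "\<And>i. finite (J i)" and sep: "separated J" and m: "m \<in> ternary_freqs J"
    and g: "g \<in> signs (SIGMA i:UNIV. J i)"
    and sum0: "(\<Sum>b\<in>(SIGMA i:UNIV. J i). g b * ((\<lambda>(i, j). 9 ^ j) b - 2 * idot m ((\<lambda>(i, j). axis i (3 ^ j)) b))) = 0"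
  shows "\<forall>b\<in>(SIGMA i:UNIV. J i). g b = 0"
proof -
  obtain p where p: "\<And>i. p i \<in> J i" and m: "m = ternary_freq p"
    using m by (auto simp: ternary_freqs_def)
  define v where "v = (\<lambda>(i, j). j + min j (p i))"
  define u :: "'d \<times> nat \<Rightarrow> int" where
    "u = (\<lambda>(i, j). if j \<le> p i then 1 - 2 * 3 ^ (p i - j) else 3 ^ (j - p i) - 2)"
  have factor: "(\<lambda>(i, j). 9 ^ j) b - 2 * idot m ((\<lambda>(i, j). axis i (3 ^ j)) b) = 3 ^ v b * u b" for b
  proof (cases b)
    case (Pair i j)
    have nine: "(9::int) ^ j = 3 ^ j * 3 ^ j"
      using power_mult_distrib[of "3::int" 3 j] by simp
    have line_freq: "(\<lambda>(i, j). 9 ^ j) b - 2 * idot m ((\<lambda>(i, j). axis i (3 ^ j)) b) = 3 ^ j * 3 ^ j - 2 * (3 ^ p i * 3 ^ j)"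
      by (simp only: Pair prod.case m ternary_freq_def idot_axis nine vec_lambda_beta)
    show ?thesis
    proof (cases "j \<le> p i")
      case True
      then obtain r where r: "p i = j + r"
        using le_Suc_ex by blast
      have "x * x - 2 * ((x * y) * x) = x * x * (1 - 2 * y)" for x y :: int
        by (simp add: algebra_simps)
      moreover have "v b = j + j" "u b = 1 - 2 * 3 ^ r"
        by (simp_all add: Pair v_def u_def r)
      ultimately show ?thesis
        by (simp only: line_freq r power_add)
    next
      case False
      then obtain r where r: "j = p i + r" and "r \<noteq> 0"
        by (metis le_Suc_ex nat_le_linear add_0_right order_refl)
      have "(x * y) * (x * y) - 2 * (x * (x * y)) = (x * y) * x * (y - 2)" for x y :: int
        by (simp add: algebra_simps)
      moreover have "v b = j + p i" "u b = 3 ^ r - 2"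
        using \<open>r \<noteq> 0\<close> by (simp_all add: Pair v_def u_def r)
      ultimately show ?thesis
        by (simp only: line_freq r power_add)
    qed
  qed
  have "inj_on v (SIGMA i:UNIV. J i)"
  proof (rule inj_onI)
    fix b b' assume bs: "b \<in> (SIGMA i:UNIV. J i)" "b' \<in> (SIGMA i:UNIV. J i)" and vb: "v b = v b'"
    obtain i j i' j' where b: "b = (i, j)" and b': "b' = (i', j')"
      by (cases b, cases b') blast
    have j: "j \<in> J i" "j' \<in> J i'" and eq: "j + min j (p i) = j' + min j' (p i')"
      using bs vb by (auto simp: b b' v_def)
    have "i = i' \<and> j = j'"
    proof (cases "i = i'")
      case True
      with eq show ?thesis
        by (auto simp: min_def split: if_splits)
    next
      case False
      with sep have "(\<forall>j\<in>J i. \<forall>j'\<in>J i'. j < j') \<or> (\<forall>j\<in>J i. \<forall>j'\<in>J i'. j' < j)"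
        by (simp add: separated_def)
      then have "(j < j' \<and> j < p i') \<or> (j' < j \<and> j' < p i)"
        using j p by blast
      with eq show ?thesis
        by (auto simp: min_def split: if_splits)
    qed
    then show "b = b'"
      by (simp add: b b')
  qed
  moreover have "\<not> 3 dvd u b" for b
  proof (cases b)
    case (Pair i j)
    show ?thesis
    proof (cases "p i" j rule: linorder_cases)
      case less
      then obtain r where "j = p i + Suc r"
        using less_imp_Suc_add by auto
      then show ?thesis
        by (simp add: u_def Pair) presburger
    next
      case greater
      then obtain r where "p i = j + Suc r"
        using less_imp_Suc_add by auto
      then show ?thesis
        by (simp add: u_def Pair) presburger
    qed (simp add: u_def Pair)
  qed
  ultimately show ?thesis
    using fin g sum0 unfolding factor
    by (intro signed_sum_distinct_valuations[of "SIGMA i:UNIV. J i" v u g]) auto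
qed

text \<open>
  In each coordinate, \<open>(l\<^sub>i e\<^sub>i, l\<^sub>i\<^sup>2) - (k\<^sub>i e\<^sub>i, k\<^sub>i\<^sup>2)\<close> is a difference of two of the frequencies of the
  weight, or zero; \<open>|k|\<^sup>2\<close> is additive over the coordinates, so summation over \<open>i\<close>
  uses at most \<open>2d\<close> signs.
\<close>
lemma ternary_differences:
  fixes J :: "'d::finite \<Rightarrow> nat set"
  assumes fin: "\<And>i. finite (J i)" and k: "k \<in> ternary_freqs J" and l: "l \<in> ternary_freqs J"
  shows "\<exists>g\<in>signs (SIGMA i:UNIV. J i). card {b\<in>(SIGMA i:UNIV. J i). g b \<noteq> 0} \<le> 2 * CARD('d) \<and>
     (\<Sum>b\<in>(SIGMA i:UNIV. J i). g b *s (\<lambda>(i, j). axis i (3 ^ j)) b) = l - k \<and>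
     (\<Sum>b\<in>(SIGMA i:UNIV. J i). g b * (\<lambda>(i, j). 9 ^ j) b) = idot l l - idot k k"
proof -
  let ?B = "SIGMA i:UNIV. J i"
  obtain p where p: "\<And>i. p i \<in> J i" and k: "k = ternary_freq p"
    using k by (auto simp: ternary_freqs_def)
  obtain q where q: "\<And>i. q i \<in> J i" and l: "l = ternary_freq q"
    using l by (auto simp: ternary_freqs_def)
  \<comment> \<open>The signs \<open>+1\<close> at \<open>(i, q i)\<close> and \<open>-1\<close> at \<open>(i, p i)\<close> cancel to \<open>0\<close> where \<open>p i = q i\<close>.\<close>
  define g :: "'d \<times> nat \<Rightarrow> int" where
    "g = (\<lambda>b\<in>?B. of_bool (snd b = q (fst b)) - of_bool (snd b = p (fst b)))"
  have "g \<in> signs ?B"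
    by (auto simp: g_def signs_def)
  moreover have "card {b\<in>?B. g b \<noteq> 0} \<le> 2 * CARD('d)"
  proof -
    have "{b\<in>?B. g b \<noteq> 0} \<subseteq> range (\<lambda>i. (i, q i)) \<union> range (\<lambda>i. (i, p i))"
      by (auto simp: g_def)
    then have "card {b\<in>?B. g b \<noteq> 0} \<le> card (range (\<lambda>i. (i, q i)) \<union> range (\<lambda>i. (i, p i)))"
      by (intro card_mono) auto
    also have "\<dots> \<le> card (range (\<lambda>i. (i, q i))) + card (range (\<lambda>i. (i, p i)))"
      by (rule card_Un_le)
    also have "\<dots> \<le> CARD('d) + CARD('d)"
      by (intro add_mono card_image_le) auto
    finally show ?thesis by simp
  qed
  moreover have telescope: "(\<Sum>b\<in>?B. g b * f b) = (\<Sum>i\<in>UNIV. f (i, q i) - f (i, p i))" for f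
  proof -
    have "(\<Sum>b\<in>?B. g b * f b) = (\<Sum>i\<in>UNIV. \<Sum>j\<in>J i. (of_bool (j = q i) - of_bool (j = p i)) * f (i, j))"
      by (subst sum.Sigma) (auto simp: fin g_def intro!: sum.cong)
    also have "\<dots> = (\<Sum>i\<in>UNIV. (\<Sum>j\<in>J i. if j = q i then f (i, j) else 0) - (\<Sum>j\<in>J i. if j = p i then f (i, j) else 0))"
      unfolding sum_subtractf[symmetric] by (intro sum.cong refl) auto
    also have "\<dots> = (\<Sum>i\<in>UNIV. f (i, q i) - f (i, p i))"
      using p q fin by simp
    finally show ?thesis .
  qed
  moreover have "(\<Sum>b\<in>?B. g b *s (\<lambda>(i, j). axis i (3 ^ j)) b) = l - k"
  proof (rule vec_eq_iff[THEN iffD2], rule allI)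
    fix i0
    have "(\<Sum>b\<in>?B. g b *s (\<lambda>(i, j). axis i (3 ^ j)) b) $ i0 = (\<Sum>b\<in>?B. g b * (if fst b = i0 then 3 ^ snd b else 0))"
      by (simp add: case_prod_beta axis_def) (intro sum.cong refl, auto)
    also have "\<dots> = (\<Sum>i\<in>UNIV. if i = i0 then 3 ^ q i - 3 ^ p i else 0)"
      unfolding telescope by (intro sum.cong) auto
    also have "\<dots> = (l - k) $ i0"
      by (simp add: k l ternary_freq_def)
    finally show "(\<Sum>b\<in>?B. g b *s (\<lambda>(i, j). axis i (3 ^ j)) b) $ i0 = (l - k) $ i0" .
  qed
  moreover have "(\<Sum>b\<in>?B. g b * (\<lambda>(i, j). 9 ^ j) b) = idot l l - idot k k"
    unfolding telescope
    by (simp add: idot_def k l ternary_freq_def sum_subtractf flip: power_mult_distrib)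
  ultimately show ?thesis
    by blast
qed

lemma mt_constant_ternary_ge:
  fixes J :: "'d::finite \<Rightarrow> nat set"
  assumes fin: "\<And>i. finite (J i)" and ne: "\<And>i. J i \<noteq> {}" and sep: "separated J"
    and mt: "mt_ineq C (ternary_weight J) (dirichlet_sum (ternary_freqs J))"
  shows "ennreal ((\<Prod>i\<in>UNIV. real (card (J i))) / 4 ^ CARD('d)) \<le> C"
proof -
  have "card (ternary_freqs J) \<noteq> 0"
    by (simp add: card_ternary_freqs fin ne)
  then have "ternary_freqs J \<noteq> {}"
    by auto
  have "ennreal (real (card (ternary_freqs J)) / 2 ^ (2 * CARD('d))) \<le> C"
  proof (rule mt_constant_riesz_product_ge[where B = "SIGMA i:UNIV. J i"
        and \<beta> = "\<lambda>(i, j). axis i (3 ^ j)" and \<tau> = "\<lambda>(i, j). 9 ^ j"])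
    show "finite (SIGMA i:UNIV. J i)" "finite (ternary_freqs J)" "ternary_freqs J \<noteq> {}"
      by (simp_all add: fin finite_ternary_freqs \<open>ternary_freqs J \<noteq> {}\<close>)
    show "mt_ineq C (riesz_product (SIGMA i:UNIV. J i) (\<lambda>(i, j). axis i (3 ^ j)) (\<lambda>(i, j). 9 ^ j))
        (dirichlet_sum (ternary_freqs J))"
      using mt by (simp only: ternary_weight_def)
  qed (fact ternary_dissociated[OF fin sep] ternary_differences[OF fin])+
  then show ?thesis
    by (simp add: card_ternary_freqs power_mult)
qed

lemma ternary_weight_in_weights: "ternary_weight J \<in> weights"
  unfolding ternary_weight_def by (rule riesz_product_in_weights)

section \<open>Lower bounds for the constants\<close>

lemma ex_index_enumeration: "\<exists>e :: 'd::finite \<Rightarrow> nat. inj e \<and> (\<forall>i. e i < CARD('d))"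
proof -
  obtain e :: "'d \<Rightarrow> nat" where "bij_betw e UNIV {0..<CARD('d)}"
    using ex_bij_betw_finite_nat[of "UNIV :: 'd set"] by auto
  then have "inj e \<and> (\<forall>i. e i < CARD('d))"
    by (auto simp: bij_betw_def)
  then show ?thesis by blast
qed

text \<open>
  One coordinate takes \<open>n\<close> exponents, the others a single larger exponent each.
\<close>
lemma mt_const_card_ge: "ennreal (1 / 4 ^ CARD('d)) * of_nat n \<le> mt_const_card TYPE('d::finite) n" if "n > 0"
proof -
  obtain e :: "'d \<Rightarrow> nat" where e: "inj e" "\<And>i. e i < CARD('d)"
    using ex_index_enumeration by blast
  define i0 :: 'd where "i0 = undefined"
  define J where "J i = (if i = i0 then {..<n} else {n + e i})" for i
  have fin: "finite (J i)" and ne: "J i \<noteq> {}" for i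
    using that by (auto simp: J_def)
  have sep: "separated J"
    unfolding separated_def
  proof (intro allI impI)
    fix i i' :: 'd assume "i \<noteq> i'"
    then have "e i \<noteq> e i'"
      using e(1) by (auto dest: injD)
    then show "(\<forall>j\<in>J i. \<forall>j'\<in>J i'. j < j') \<or> (\<forall>j\<in>J i. \<forall>j'\<in>J i'. j' < j)"
      using \<open>i \<noteq> i'\<close> by (auto simp: J_def)
  qed
  have "(\<Prod>i\<in>UNIV. card (J i)) = (\<Prod>i\<in>UNIV. if i = i0 then n else 1)"
    by (intro prod.cong) (auto simp: J_def)
  then have card_J: "(\<Prod>i\<in>UNIV. card (J i)) = n"
    by simp
  have tp: "dirichlet_sum (ternary_freqs J) \<in> trig_polys"
    by (intro dirichlet_sum_trig_poly finite_ternary_freqs fin)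
  show ?thesis
    unfolding mt_const_card_def
  proof (rule Inf_greatest, clarify)
    fix C assume C: "\<forall>w\<in>weights. \<forall>u0\<in>trig_polys. card (spectrum u0 :: (int ^ 'd) set) = n \<longrightarrow> mt_ineq C w u0"
    have "card (spectrum (dirichlet_sum (ternary_freqs J))) = n"
      by (simp add: spectrum_dirichlet_sum finite_ternary_freqs fin card_ternary_freqs card_J)
    then have "mt_ineq C (ternary_weight J) (dirichlet_sum (ternary_freqs J))"
      using C ternary_weight_in_weights[of J] tp by blast
    from mt_constant_ternary_ge[OF fin ne sep this]
    have "ennreal (real n / 4 ^ CARD('d)) \<le> C"
      by (simp add: card_J flip: of_nat_prod)
    then show "ennreal (1 / 4 ^ CARD('d)) * of_nat n \<le> C"
      by (simp add: ennreal_of_nat_eq_real_of_nat flip: ennreal_mult)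
  qed
qed

text \<open>
  The exponents below \<open>dL\<close> are split into \<open>d\<close> consecutive blocks of length \<open>L\<close>, one for each
  coordinate.
\<close>
lemma mt_const_ge:
  fixes L :: nat
  assumes "L > 0" and N: "3 ^ (CARD('d) * L) \<le> N"
  shows "ennreal ((real L / 4) ^ CARD('d)) \<le> mt_const TYPE('d::finite) N"
proof -
  obtain e :: "'d \<Rightarrow> nat" where e: "inj e" "\<And>i. e i < CARD('d)"
    using ex_index_enumeration by blast
  define J where "J i = {e i * L ..< Suc (e i) * L}" for i
  have fin: "finite (J i)" and ne: "J i \<noteq> {}" for i
    using \<open>L > 0\<close> by (auto simp: J_def)
  have sep: "separated J"
    unfolding separated_def
  proof (intro allI impI)
    have less: "j < j'" if "e i < e i'" "j \<in> J i" "j' \<in> J i'" for i i' j j'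
    proof -
      have "j < Suc (e i) * L" and "e i' * L \<le> j'"
        using that(2,3) by (auto simp: J_def)
      moreover have "Suc (e i) * L \<le> e i' * L"
        by (rule mult_le_mono1) (use that(1) in simp)
      ultimately show ?thesis by linarith
    qed
    fix i i' :: 'd assume "i \<noteq> i'"
    then have "e i < e i' \<or> e i' < e i"
      using e(1) by (metis injD linorder_neqE_nat)
    then show "(\<forall>j\<in>J i. \<forall>j'\<in>J i'. j < j') \<or> (\<forall>j\<in>J i. \<forall>j'\<in>J i'. j' < j)"
      using less by blast
  qed
  have sub: "ternary_freqs J \<subseteq> in_box N"
  proof
    fix k assume "k \<in> ternary_freqs J"
    then obtain p where p: "\<And>i. p i \<in> J i" and k: "k = ternary_freq p"
      by (auto simp: ternary_freqs_def)
    have "\<bar>real_of_int (k $ i)\<bar> \<le> N" for i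
    proof -
      have "Suc (e i) * L \<le> CARD('d) * L"
        by (rule mult_le_mono1) (use e(2)[of i] in simp)
      moreover have "p i < Suc (e i) * L"
        using p[of i] by (simp add: J_def)
      ultimately have "(3::real) ^ p i \<le> 3 ^ (CARD('d) * L)"
        by (intro power_increasing) auto
      also note N
      finally show ?thesis
        by (simp add: k ternary_freq_def)
    qed
    then show "k \<in> in_box N"
      by (simp add: in_box_def)
  qed
  have tp: "dirichlet_sum (ternary_freqs J) \<in> trig_polys"
    by (intro dirichlet_sum_trig_poly finite_ternary_freqs fin)
  show ?thesis
    unfolding mt_const_def
  proof (rule Inf_greatest, clarify)
    fix C assume C: "\<forall>w\<in>weights. \<forall>u0\<in>trig_polys. spectrum u0 \<subseteq> (in_box N :: (int ^ 'd) set) \<longrightarrow> mt_ineq C w u0"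
    have "spectrum (dirichlet_sum (ternary_freqs J)) \<subseteq> in_box N"
      by (simp add: spectrum_dirichlet_sum finite_ternary_freqs fin sub)
    then have "mt_ineq C (ternary_weight J) (dirichlet_sum (ternary_freqs J))"
      using C ternary_weight_in_weights[of J] tp by blast
    from mt_constant_ternary_ge[OF fin ne sep this]
    show "ennreal ((real L / 4) ^ CARD('d)) \<le> C"
      by (simp add: J_def power_divide)
  qed
qed

text \<open>
  Take \<open>L\<close> to be the integer part of \<open>log\<^sub>3 N / d\<close>. For \<open>N \<ge> 3\<^sup>d\<close> rounding loses at most a factor
  of two, which together with the \<open>4\<close> of the previous lemma gives the \<open>8\<close> in the constant.
\<close>
lemma mt_const_log_lower_bound:
  "\<exists>c>0. \<forall>\<^sub>F N in at_top. ennreal c * ennreal (ln N ^ CARD('d)) \<le> mt_const TYPE('d::finite) N"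
proof (intro exI conjI)
  define d where "d = CARD('d)"
  define a where "a = 1 / (8 * real d * ln 3)"
  have d: "0 < d"
    by (simp add: d_def)
  show "0 < a ^ d"
    using d by (simp add: a_def)
  show "\<forall>\<^sub>F N in at_top. ennreal (a ^ d) * ennreal (ln N ^ CARD('d)) \<le> mt_const TYPE('d) N"
    using eventually_ge_at_top[of "3 ^ d :: real"]
  proof eventually_elim
    case (elim N)
    define L where "L = nat \<lfloor>log 3 N / d\<rfloor>"
    have "1 \<le> N"
      using elim one_le_power[of "3::real" d] by linarith
    have "log 3 (3 ^ d) \<le> log 3 N"
      using elim by (intro log_mono) auto
    then have ge1: "1 \<le> log 3 N / d"
      using d by (simp add: log_nat_power field_simps)
    then have "1 \<le> \<lfloor>log 3 N / d\<rfloor>"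
      by simp
    then have "real L = of_int \<lfloor>log 3 N / d\<rfloor>" and "1 \<le> real_of_int \<lfloor>log 3 N / d\<rfloor>"
      by (simp_all add: L_def)
    then have L: "1 \<le> real L" and L_le: "real L \<le> log 3 N / d" and L_ge: "log 3 N / d \<le> 2 * real L"
      by linarith+
    have "(3::real) ^ (d * L) = 3 powr (real d * real L)"
      by (simp add: powr_realpow flip: of_nat_mult)
    also have "\<dots> \<le> 3 powr (log 3 N)"
      using L_le d by (intro powr_mono) (auto simp: field_simps)
    also have "\<dots> = N"
      using \<open>1 \<le> N\<close> by simp
    finally have "ennreal ((real L / 4) ^ d) \<le> mt_const TYPE('d) N"
      unfolding d_def by (intro mt_const_ge) (use L in auto)
    moreover have "a ^ d * ln N ^ d \<le> (real L / 4) ^ d"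
    proof -
      have "a * ln N = log 3 N / d / 8"
        by (simp add: a_def log_def)
      also have "\<dots> \<le> real L / 4"
        using L_ge by simp
      finally show ?thesis
        unfolding power_mult_distrib[symmetric] using \<open>1 \<le> N\<close>
        by (intro power_mono) (auto simp: a_def)
    qed
    moreover have "ennreal (a ^ d) * ennreal (ln N ^ d) = ennreal (a ^ d * ln N ^ d)"
      using \<open>1 \<le> N\<close> by (intro ennreal_mult[symmetric]) (auto simp: a_def)
    ultimately show ?case
      by (simp add: d_def) (meson ennreal_leI order.trans)
  qed
qed

theorem theorem1p5:
  shows "(\<exists>c::real. c > 0 \<and> (\<forall>\<^sub>F N in at_top.
            stein_const TYPE('d::finite) N \<ge> ennreal c * ennreal (ln N ^ CARD('d))))
       \<and> (\<exists>c::real. c > 0 \<and> (\<forall>\<^sub>F N in at_top.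
            mt_const TYPE('d) N \<ge> ennreal c * ennreal (ln N ^ CARD('d))))
       \<and> (\<exists>c::real. c > 0 \<and> (\<forall>\<^sub>F n in sequentially.
            stein_const_card TYPE('d) n \<ge> ennreal c * of_nat n \<and>
            of_nat n \<ge> ennreal c * stein_const_card TYPE('d) n))
       \<and> (\<exists>c::real. c > 0 \<and> (\<forall>\<^sub>F n in sequentially.
            mt_const_card TYPE('d) n \<ge> ennreal c * of_nat n \<and>
            of_nat n \<ge> ennreal c * mt_const_card TYPE('d) n))"
proof -
  obtain c0 :: real where c0: "0 < c0"
    and log: "\<forall>\<^sub>F N in at_top. ennreal c0 * ennreal (ln N ^ CARD('d)) \<le> mt_const TYPE('d) N"
    using mt_const_log_lower_bound[where 'd='d] by blast
  have log': "\<forall>\<^sub>F N in at_top. ennreal c0 * ennreal (ln N ^ CARD('d)) \<le> stein_const TYPE('d) N"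
    using log by eventually_elim (rule order.trans[OF _ mt_const_le_stein_const])
  define c :: real where "c = 1 / 4 ^ CARD('d)"
  have c: "0 < c" "c \<le> 1"
    by (simp_all add: c_def)
  have "ennreal c \<le> 1"
    using c by (simp add: ennreal_le_1)
  have upper: "ennreal c * X \<le> of_nat n" if "X \<le> of_nat n" for X :: ennreal and n
    using mult_mono[OF \<open>ennreal c \<le> 1\<close> that] by simp
  have "\<forall>\<^sub>F n in sequentially.
      ennreal c * of_nat n \<le> mt_const_card TYPE('d) n \<and> mt_const_card TYPE('d) n \<le> stein_const_card TYPE('d) n
      \<and> stein_const_card TYPE('d) n \<le> of_nat n"
    using eventually_gt_at_top[of 0]
    by eventually_elim (simp add: c_def mt_const_card_ge mt_const_card_le_stein_const_card stein_const_card_le)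
  then have "\<forall>\<^sub>F n in sequentially. stein_const_card TYPE('d) n \<ge> ennreal c * of_nat n \<and>
            of_nat n \<ge> ennreal c * stein_const_card TYPE('d) n"
    and "\<forall>\<^sub>F n in sequentially. mt_const_card TYPE('d) n \<ge> ennreal c * of_nat n \<and>
            of_nat n \<ge> ennreal c * mt_const_card TYPE('d) n"
    by (eventually_elim, meson order.trans upper)+
  with c c0 log log' show ?thesis
    by blast
qed

end
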